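(* Let $m,n\ge2$, let $\varphi\in\overline{\Phi}_m\cup\Psi_m$, let $K_1,\dots,K_m\in\mathcal{S}_{c+}^n$, let $G:(0,\infty)\times S^{n-1}\to(0,\infty)$ be continuous, and for $0\ne q\in\mathbb{R}$ let $$\varphi_q(x)=\varphi(x_1^{1/q},\dots,x_m^{1/q})\ \text{ for }x=(x_1,\dots,x_m)\in(0,\infty)^m,\qquad G_q(t,u)=\frac{G(t,u)}{t^q}\ \text{ for }t>0,\ u\in S^{n-1}.$$ Write $S=\widetilde{+}_\varphi(K_1,\dots,K_m)$ for the radial Orlicz sum. Suppose that $\varphi_q$ is convex and either $q>0$ and $t\mapsto G_q(t,u)$ is increasing for each $u\in S^{n-1}$, or $q<0$ and $t\mapsto G_q(t,u)$ is decreasing for each $u\in S^{n-1}$. Then $$1\ge\varphi\!\left(\left(\frac{\widetilde{V}_G(K_1)}{\widetilde{V}_G(S)}\right)^{1/q},\dots,\left(\frac{\widetilde{V}_G(K_m)}{\widetilde{V}_G(S)}\right)^{1/q}\right).$$ The reverse inequality holds if instead $\varphi_q$ is concave and either $q>0$ and $t\mapsto G_q(t,u)$ is decreasing for each $u$, or $q<0$ and $t\mapsto G_q(t,u)$ is increasing for each $u$. If in addition $\varphi_q$ is strictly convex (or strictly concave, as appropriate) and equality holds in the inequality above, then $K_1,\dots,K_m$ are dilatates of each other.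
   Context: $\mathcal{S}_{c+}^n$ is the class of star bodies in $\mathbb{R}^n$: compact sets $L$ that are star-shaped about the origin $o$ and whose radial function $\rho_L(u)=\sup\{\lambda>0:\lambda u\in L\}$, $u\in S^{n-1}$, is positive and continuous on $S^{n-1}$ (so a star body is determined by its radial function). Two star bodies are dilatates of each other if one is $c$ times the other for some $c>0$. The general dual volume is $\widetilde{V}_G(K)=\int_{S^{n-1}}G(\rho_K(u),u)\,du$, where $du=d\mathcal{H}^{n-1}(u)$. $\overline{\Phi}_m$ is the set of continuous functions $\varphi:[0,\infty)^m\to[0,\infty)$ that are strictly increasing in each component and such that $\varphi(o)=0$, $\varphi(e_j)=1$ for $1\le j\le m$ (with $e_j$ the canonical basis vectors), and $\lim_{t\to\infty}\varphi(tx)=\infty$ for $x\in[0,\infty)^m\setminus\{o\}$. $\Psi_m$ is the set of continuous functions $\varphi:(0,\infty)^m\to(0,\infty)$ of the form $\varphi(x)=\varphi_0(1/x_1,\dots,1/x_m)$ for some $\varphi_0\in\overline{\Phi}_m$. For $\varphi\in\overline{\Phi}_m\cup\Psi_m$ and $K_1,\dots,K_m\in\mathcal{S}_{c+}^n$, the radial Orlicz sum $\widetilde{+}_\varphi(K_1,\dots,K_m)\in\mathcal{S}_{c+}^n$ is the star body $S$ whose radial function satisfies $\varphi\big(\rho_{K_1}(u)/\rho_S(u),\dots,\rho_{K_m}(u)/\rho_S(u)\big)=1$ for $u\in S^{n-1}$. *)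

theory Defs
  imports "HOL-Analysis.Analysis"
begin

text \<open>
  The Hausdorff measure of integer dimension \<open>k\<close>, normalised so that it agrees with Lebesgue
  measure when \<open>k\<close> is the dimension of the ambient Euclidean space. Covering sets must be
  required to be bounded, because \<^const>\<open>diameter\<close> is unspecified on unbounded sets; the empty set
  is treated separately so that it contributes nothing even when \<open>k = 0\<close>.
\<close>

definition hausdorff_content :: "nat \<Rightarrow> real \<Rightarrow> 'a::metric_space set \<Rightarrow> ennreal" where
  "hausdorff_content k \<delta> A =
    (INF U\<in>{U :: nat \<Rightarrow> 'a set. A \<subseteq> (\<Union>i. U i) \<and> (\<forall>i. bounded (U i) \<and> diameter (U i) \<le> \<delta>)}.
      \<Sum>i. if U i = {} then 0
          else ennreal (unit_ball_vol (real k) * (diameter (U i) / 2) ^ k))"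

definition hausdorff_outer :: "nat \<Rightarrow> 'a::metric_space set \<Rightarrow> ennreal" where
  "hausdorff_outer k A = (SUP \<delta>\<in>{0<..}. hausdorff_content k \<delta> A)"

text \<open>
  \<^const>\<open>measure_of\<close> returns the zero measure when its argument is not countably additive; this is
  not the case here, since \<open>hausdorff_outer k\<close> is a metric outer measure and hence countably
  additive on the Borel sets.
\<close>

definition hausdorff_measure :: "nat \<Rightarrow> 'a::metric_space measure" where
  "hausdorff_measure k = measure_of UNIV (sets borel) (hausdorff_outer k)"

text \<open>
  Inserting \<open>0\<close> fixes the convention that the supremum of the empty set is \<open>0\<close> (it is an
  unspecified real number otherwise); it changes nothing when the set is nonempty.
\<close>

definition radial :: "'a::real_normed_vector set \<Rightarrow> 'a \<Rightarrow> real" where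
  "radial L u = Sup (insert 0 {t. t > 0 \<and> t *\<^sub>R u \<in> L})"

definition star_body :: "'a::real_normed_vector set \<Rightarrow> bool" where
  "star_body L \<longleftrightarrow> compact L \<and> (\<forall>x\<in>L. closed_segment 0 x \<subseteq> L) \<and>
    (\<forall>u\<in>sphere 0 1. radial L u > 0) \<and> continuous_on (sphere 0 1) (radial L)"

definition dilatates :: "'a::real_vector set \<Rightarrow> 'a set \<Rightarrow> bool" where
  "dilatates K L \<longleftrightarrow> (\<exists>c>0. K = (\<lambda>x. c *\<^sub>R x) ` L)"

definition dual_volume :: "(real \<Rightarrow> real^'n \<Rightarrow> real) \<Rightarrow> (real^'n) set \<Rightarrow> real" where
  "dual_volume G K =
    (LINT u:sphere 0 1|hausdorff_measure (CARD('n) - 1). G (radial K u) u)"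

definition nonneg_orthant :: "(real^'m) set" where
  "nonneg_orthant = {x. \<forall>j. 0 \<le> x $ j}"

definition pos_orthant :: "(real^'m) set" where
  "pos_orthant = {x. \<forall>j. 0 < x $ j}"

text \<open>
  Functions on an orthant are represented by total functions whose values elsewhere are
  irrelevant.
\<close>

definition Phi_bar :: "(real^'m \<Rightarrow> real) set" where
  "Phi_bar = {\<phi>.
    continuous_on nonneg_orthant \<phi> \<and> (\<forall>x\<in>nonneg_orthant. 0 \<le> \<phi> x) \<and>
    (\<forall>x\<in>nonneg_orthant. \<forall>y\<in>nonneg_orthant. \<forall>j.
      x $ j < y $ j \<and> (\<forall>i. i \<noteq> j \<longrightarrow> x $ i = y $ i) \<longrightarrow> \<phi> x < \<phi> y) \<and>
    \<phi> 0 = 0 \<and> (\<forall>j. \<phi> (axis j 1) = 1) \<and>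
    (\<forall>x\<in>nonneg_orthant - {0}. filterlim (\<lambda>t. \<phi> (t *\<^sub>R x)) at_top at_top)}"

definition Psi :: "(real^'m \<Rightarrow> real) set" where
  "Psi = {\<phi>. continuous_on pos_orthant \<phi> \<and> (\<forall>x\<in>pos_orthant. 0 < \<phi> x) \<and>
    (\<exists>\<phi>0\<in>Phi_bar. \<forall>x\<in>pos_orthant. \<phi> x = \<phi>0 (\<chi> j. 1 / x $ j))}"

definition radial_orlicz_sum ::
  "(real^'m \<Rightarrow> real) \<Rightarrow> ('m \<Rightarrow> (real^'n) set) \<Rightarrow> (real^'n) set" where
  "radial_orlicz_sum \<phi> K =
    (THE S. star_body S \<and>
      (\<forall>u\<in>sphere 0 1. \<phi> (\<chi> j. radial (K j) u / radial S u) = 1))"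

definition phi_q :: "(real^'m \<Rightarrow> real) \<Rightarrow> real \<Rightarrow> real^'m \<Rightarrow> real" where
  "phi_q \<phi> q x = \<phi> (\<chi> j. x $ j powr (1 / q))"

definition G_q :: "(real \<Rightarrow> real^'n \<Rightarrow> real) \<Rightarrow> real \<Rightarrow> real \<Rightarrow> real^'n \<Rightarrow> real" where
  "G_q G q t u = G t u / t powr q"

definition strictly_convex_on :: "'a::real_vector set \<Rightarrow> ('a \<Rightarrow> real) \<Rightarrow> bool" where
  "strictly_convex_on S f \<longleftrightarrow> convex S \<and>
    (\<forall>x\<in>S. \<forall>y\<in>S. \<forall>u>0. \<forall>v>0. x \<noteq> y \<and> u + v = 1 \<longrightarrow>
      f (u *\<^sub>R x + v *\<^sub>R y) < u * f x + v * f y)"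

definition strictly_concave_on :: "'a::real_vector set \<Rightarrow> ('a \<Rightarrow> real) \<Rightarrow> bool" where
  "strictly_concave_on S f \<longleftrightarrow> strictly_convex_on S (\<lambda>x. - f x)"

end

theory Submission
  imports Defs
begin

text \<open>
  Write \<open>\<rho> j\<close> and \<open>s\<close> for the radial functions of \<open>K j\<close> and of the Orlicz sum \<open>S\<close>, let \<open>f = phi_q \<phi> q\<close>, and
  put \<open>x u $ j = (\<rho> j u / s u) powr q\<close>. The equation that defines \<open>S\<close> says that \<open>f (x u) = 1\<close> for every
  direction \<open>u\<close>. Let \<open>b\<close> be the mean of \<open>x\<close> for the probability measure on the sphere with density
  proportional to \<open>w u = G (s u) u\<close>. If \<open>f\<close> is convex, then Jensen's inequality gives \<open>f b \<le> 1\<close>; as \<open>f\<close> is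
  constant on the range of \<open>x\<close>, this only needs that \<open>b\<close> lies in the convex hull of that range
  (\<open>mean_in_sublevel\<close>). If \<open>f\<close> is concave, the same applies to \<open>-f\<close>.

  It remains to compare \<open>b\<close> with the vector \<open>y\<close> of the quotients of dual volumes. The value at \<open>u\<close> of the
  integrand of \<open>b $ j\<close> is \<open>G_q G q (s u) u * \<rho> j u powr q\<close> and that of \<open>y $ j\<close> is
  \<open>G_q G q (\<rho> j u) u * \<rho> j u powr q\<close>, up to the common normalisation. As \<open>f (x u) = 1\<close>, the order of
  \<open>\<rho> j u\<close> and \<open>s u\<close> is known, and it agrees with the direction in which \<open>f\<close> is monotone
  (\<open>phi_q_order_cases\<close>). So the monotonicity of \<open>G_q\<close> gives \<open>f y \<le> f b\<close> in the convex and \<open>f b \<le> f y\<close> in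
  the concave case, for both signs of \<open>q\<close> and both classes of \<open>\<phi>\<close>.

  Equality forces \<open>f b = 1\<close>. If \<open>f\<close> is strictly convex or strictly concave, then \<open>x\<close> is constant
  (\<open>mean_on_level_imp_constant\<close>), so all \<open>\<rho> j\<close> are constant multiples of \<open>s\<close> and the bodies are dilatates.

  Two facts about the objects themselves are needed. The measure on the sphere must be finite and must
  be positive on nonempty open sets. This is derived from the definition of Hausdorff measure:
  Caratheodory's criterion makes it a measure on the Borel sets, and comparing volumes in the ambient
  space bounds it from above, by packing balls into a thin shell, and from below, by covering cones with
  tubes. And the radial Orlicz sum must exist; the intermediate value theorem gives its radius in every
  direction, and monotonicity along rays gives the uniqueness and the continuity of this radius.
\<close>

section \<open>Hausdorff measure as a metric outer measure\<close>

text \<open>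
  In a Euclidean space of dimension \<open>k\<close> this is the volume of a ball with the diameter of \<open>U\<close>.
\<close>

definition diam_weight :: "nat \<Rightarrow> 'a::metric_space set \<Rightarrow> ennreal" where
  "diam_weight k U = (if U = {} then 0 else ennreal (unit_ball_vol (real k) * (diameter U / 2) ^ k))"

definition fine_cover :: "real \<Rightarrow> 'a::metric_space set \<Rightarrow> (nat \<Rightarrow> 'a set) \<Rightarrow> bool" where
  "fine_cover \<delta> A U \<longleftrightarrow> A \<subseteq> (\<Union>i. U i) \<and> (\<forall>i. bounded (U i) \<and> diameter (U i) \<le> \<delta>)"

lemma hausdorff_content_fine_cover:
  "hausdorff_content k \<delta> A = (INF U\<in>Collect (fine_cover \<delta> A). \<Sum>i. diam_weight k (U i))"
  unfolding hausdorff_content_def fine_cover_def diam_weight_def by simp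

lemma hausdorff_content_le:
  "fine_cover \<delta> A U \<Longrightarrow> hausdorff_content k \<delta> A \<le> (\<Sum>i. diam_weight k (U i))"
  unfolding hausdorff_content_fine_cover by (rule INF_lower) simp

lemma le_hausdorff_content:
  "(\<And>U. fine_cover \<delta> A U \<Longrightarrow> c \<le> (\<Sum>i. diam_weight k (U i))) \<Longrightarrow> c \<le> hausdorff_content k \<delta> A"
  unfolding hausdorff_content_fine_cover by (rule INF_greatest) simp

lemma hausdorff_content_mono:
  assumes "A \<subseteq> B" "\<delta> \<le> \<delta>'"
  shows "hausdorff_content k \<delta>' A \<le> hausdorff_content k \<delta> B"
proof (rule le_hausdorff_content)
  fix U assume "fine_cover \<delta> B U"
  then have "fine_cover \<delta>' A U"
    using assms unfolding fine_cover_def by (meson order_trans)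
  then show "hausdorff_content k \<delta>' A \<le> (\<Sum>i. diam_weight k (U i))"
    by (rule hausdorff_content_le)
qed

lemma hausdorff_content_empty:
  assumes "0 \<le> \<delta>"
  shows "hausdorff_content k \<delta> {} = 0"
proof -
  have "fine_cover \<delta> {} (\<lambda>i. {})"
    using assms by (simp add: fine_cover_def)
  from hausdorff_content_le[OF this, of k] show ?thesis
    by (simp add: diam_weight_def)
qed

lemma hausdorff_content_UN_le:
  "hausdorff_content k \<delta> (\<Union>n. A n) \<le> (\<Sum>n. hausdorff_content k \<delta> (A n))"
proof (rule ennreal_le_epsilon)
  fix e :: real assume e: "0 < e" and fin: "(\<Sum>n. hausdorff_content k \<delta> (A n)) < top"
  have "\<exists>U. fine_cover \<delta> (A n) U \<and>
          (\<Sum>i. diam_weight k (U i)) < hausdorff_content k \<delta> (A n) + e * (1/2)^Suc n" for n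
  proof -
    have "hausdorff_content k \<delta> (A n) < hausdorff_content k \<delta> (A n) + e * (1/2)^Suc n"
      using e fin by (auto simp add: less_top dest!: ennreal_suminf_lessD)
    then show ?thesis
      by (subst (asm) hausdorff_content_fine_cover) (simp add: INF_less_iff)
  qed
  then obtain U where U: "\<And>n. fine_cover \<delta> (A n) (U n)"
    and Ule: "\<And>n. (\<Sum>i. diam_weight k (U n i)) \<le> hausdorff_content k \<delta> (A n) + e * (1/2)^Suc n"
    by (metis less_imp_le)
  define C where "C = case_prod U \<circ> prod_decode"
  have "fine_cover \<delta> (\<Union>n. A n) C"
    unfolding fine_cover_def
  proof (intro conjI allI)
    show "(\<Union>n. A n) \<subseteq> (\<Union>i. C i)"
    proof
      fix x assume "x \<in> (\<Union>n. A n)"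
      then obtain n where "x \<in> A n" by blast
      then obtain i where "x \<in> U n i" using U[of n] unfolding fine_cover_def by blast
      then have "x \<in> C (prod_encode (n, i))" by (simp add: C_def)
      then show "x \<in> (\<Union>i. C i)" by blast
    qed
    show "bounded (C i)" "diameter (C i) \<le> \<delta>" for i
      using U unfolding fine_cover_def by (simp_all add: C_def split_def)
  qed
  then have "hausdorff_content k \<delta> (\<Union>n. A n) \<le> (\<Sum>i. diam_weight k (C i))"
    by (rule hausdorff_content_le)
  also have "\<dots> = (\<Sum>i. (\<lambda>p. diam_weight k (case_prod U p)) (prod_decode i))"
    by (simp add: C_def)
  also have "\<dots> = (\<Sum>n. \<Sum>i. diam_weight k (U n i))"
    by (rule suminf_ennreal_2dimen) simp
  also have "\<dots> \<le> (\<Sum>n. hausdorff_content k \<delta> (A n) + e * (1/2) ^ Suc n)"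
    by (intro suminf_le allI Ule) auto
  also have "\<dots> = (\<Sum>n. hausdorff_content k \<delta> (A n)) + (\<Sum>n. ennreal e * ennreal ((1/2) ^ Suc n))"
    using e by (subst suminf_add[symmetric])
               (auto simp del: ennreal_suminf_cmult simp add: ennreal_mult[symmetric])
  also have "\<dots> = (\<Sum>n. hausdorff_content k \<delta> (A n)) + e"
    unfolding ennreal_suminf_cmult
    by (subst suminf_ennreal_eq[OF zero_le_power power_half_series]) auto
  finally show "hausdorff_content k \<delta> (\<Union>n. A n) \<le> (\<Sum>n. hausdorff_content k \<delta> (A n)) + ennreal e" .
qed

lemma hausdorff_content_le_outer: "0 < \<delta> \<Longrightarrow> hausdorff_content k \<delta> A \<le> hausdorff_outer k A"
  unfolding hausdorff_outer_def by (rule SUP_upper) simp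

lemma hausdorff_outer_mono: "A \<subseteq> B \<Longrightarrow> hausdorff_outer k A \<le> hausdorff_outer k B"
  unfolding hausdorff_outer_def by (rule SUP_mono) (use hausdorff_content_mono in blast)

lemma hausdorff_outer_empty: "hausdorff_outer k {} = 0"
  unfolding hausdorff_outer_def by (simp add: hausdorff_content_empty)

lemma hausdorff_outer_UN_le: "hausdorff_outer k (\<Union>n. A n) \<le> (\<Sum>n. hausdorff_outer k (A n))"
  unfolding hausdorff_outer_def[of k "\<Union>n. A n"]
proof (rule SUP_least)
  fix \<delta> :: real assume "\<delta> \<in> {0<..}"
  then have "(\<Sum>n. hausdorff_content k \<delta> (A n)) \<le> (\<Sum>n. hausdorff_outer k (A n))"
    by (intro suminf_le hausdorff_content_le_outer) auto
  then show "hausdorff_content k \<delta> (\<Union>n. A n) \<le> (\<Sum>n. hausdorff_outer k (A n))"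
    using hausdorff_content_UN_le order_trans by blast
qed

lemma hausdorff_outer_Un_le: "hausdorff_outer k (A \<union> B) \<le> hausdorff_outer k A + hausdorff_outer k B"
proof -
  have "hausdorff_outer k (\<Union>n. binaryset A B n) \<le> (\<Sum>n. hausdorff_outer k (binaryset A B n))"
    by (rule hausdorff_outer_UN_le)
  then show ?thesis
    by (simp add: UN_binaryset_eq suminf_binaryset_eq hausdorff_outer_empty)
qed

lemma outer_measure_space_hausdorff_outer: "outer_measure_space UNIV (hausdorff_outer k)"
  unfolding outer_measure_space_def positive_def increasing_def countably_subadditive_def
  using hausdorff_outer_empty hausdorff_outer_mono hausdorff_outer_UN_le by blast

text \<open>
  A member of a cover whose mesh is below the distance of \<open>A\<close> and \<open>B\<close> cannot meet both sets, so such a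
  cover of the union splits into a cover of \<open>A\<close> and a cover of \<open>B\<close> without increasing the sum. This
  is the metric property from which the measurability of closed sets follows.
\<close>

lemma hausdorff_outer_Un_separated:
  assumes d: "0 < d" and sep: "\<And>x y. x \<in> A \<Longrightarrow> y \<in> B \<Longrightarrow> d \<le> dist x y"
  shows "hausdorff_outer k A + hausdorff_outer k B \<le> hausdorff_outer k (A \<union> B)"
proof -
  have small: "hausdorff_content k \<delta> A + hausdorff_content k \<delta> B \<le> hausdorff_content k \<delta> (A \<union> B)"
    if \<delta>: "0 < \<delta>" "\<delta> < d" for \<delta>
  proof (rule le_hausdorff_content)
    fix U assume U: "fine_cover \<delta> (A \<union> B) U"
    define UA where "UA i = (if U i \<inter> A = {} then {} else U i)" for i
    define UB where "UB i = (if U i \<inter> B = {} then {} else U i)" for i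
    have "fine_cover \<delta> A UA" "fine_cover \<delta> B UB"
      using U \<delta> unfolding fine_cover_def UA_def UB_def by fastforce+
    then have "hausdorff_content k \<delta> A + hausdorff_content k \<delta> B
        \<le> (\<Sum>i. diam_weight k (UA i)) + (\<Sum>i. diam_weight k (UB i))"
      by (intro add_mono hausdorff_content_le)
    also have "\<dots> = (\<Sum>i. diam_weight k (UA i) + diam_weight k (UB i))"
      by (rule suminf_add) auto
    also have "\<dots> \<le> (\<Sum>i. diam_weight k (U i))"
    proof (rule suminf_le)
      fix i
      have "U i \<inter> A = {} \<or> U i \<inter> B = {}"
      proof (rule ccontr)
        assume "\<not> ?thesis"
        then obtain x y where xy: "x \<in> U i" "x \<in> A" "y \<in> U i" "y \<in> B" by blast
        then have "d \<le> dist x y" using sep by blast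
        also have "dist x y \<le> diameter (U i)"
          using U xy by (intro diameter_bounded_bound) (auto simp: fine_cover_def)
        also have "\<dots> \<le> \<delta>" using U by (simp add: fine_cover_def)
        finally show False using \<delta> by simp
      qed
      then show "diam_weight k (UA i) + diam_weight k (UB i) \<le> diam_weight k (U i)"
        by (auto simp: UA_def UB_def diam_weight_def)
    qed auto
    finally show "hausdorff_content k \<delta> A + hausdorff_content k \<delta> B \<le> (\<Sum>i. diam_weight k (U i))" .
  qed
  have "hausdorff_outer k A + hausdorff_outer k B
      = (SUP \<delta>\<in>{0<..}. hausdorff_content k \<delta> A + hausdorff_content k \<delta> B)"
    unfolding hausdorff_outer_def
  proof (rule SUP_add_directed_ennreal[symmetric])
    fix i j :: real assume "i \<in> {0<..}" "j \<in> {0<..}"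
    then show "\<exists>l\<in>{0<..}. hausdorff_content k i A + hausdorff_content k j B
        \<le> hausdorff_content k l A + hausdorff_content k l B"
      by (intro bexI[of _ "min i j"] add_mono hausdorff_content_mono) auto
  qed
  also have "\<dots> \<le> hausdorff_outer k (A \<union> B)"
  proof (rule SUP_least)
    fix \<delta> :: real assume \<delta>: "\<delta> \<in> {0<..}"
    define \<epsilon> where "\<epsilon> = min \<delta> (d / 2)"
    have \<epsilon>: "0 < \<epsilon>" "\<epsilon> < d" "\<epsilon> \<le> \<delta>" using \<delta> d by (auto simp: \<epsilon>_def)
    have "hausdorff_content k \<delta> A + hausdorff_content k \<delta> B
        \<le> hausdorff_content k \<epsilon> A + hausdorff_content k \<epsilon> B"
      by (intro add_mono hausdorff_content_mono \<epsilon>) auto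
    also have "\<dots> \<le> hausdorff_content k \<epsilon> (A \<union> B)" by (rule small) (use \<epsilon> in auto)
    also have "\<dots> \<le> hausdorff_outer k (A \<union> B)" by (rule hausdorff_content_le_outer) (use \<epsilon> in auto)
    finally show "hausdorff_content k \<delta> A + hausdorff_content k \<delta> B \<le> hausdorff_outer k (A \<union> B)" .
  qed
  finally show ?thesis .
qed

lemma hausdorff_outer_sum_separated:
  fixes R :: "nat \<Rightarrow> 'a::metric_space set"
  assumes sep: "\<And>i j. i < j \<Longrightarrow> \<exists>d>0. \<forall>x\<in>R i. \<forall>y\<in>R j. d \<le> dist x y"
  shows "(\<Sum>i<n. hausdorff_outer k (R i)) \<le> hausdorff_outer k (\<Union>i<n. R i)"
proof (induction n)
  case (Suc n)
  have "\<forall>i. \<exists>d>0. i < n \<longrightarrow> (\<forall>x\<in>R i. \<forall>y\<in>R n. d \<le> dist x y)"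
    using sep by (metis zero_less_one)
  then obtain d where d: "\<And>i. 0 < d i" "\<And>i x y. i < n \<Longrightarrow> x \<in> R i \<Longrightarrow> y \<in> R n \<Longrightarrow> d i \<le> dist x y"
    by metis
  define e where "e = Min (insert 1 (d ` {..<n}))"
  have e: "0 < e" "\<And>i. i < n \<Longrightarrow> e \<le> d i" using d by (auto simp: e_def)
  have "(\<Sum>i<Suc n. hausdorff_outer k (R i)) \<le> hausdorff_outer k (\<Union>i<n. R i) + hausdorff_outer k (R n)"
    using Suc by (simp add: add_right_mono)
  also have "\<dots> \<le> hausdorff_outer k ((\<Union>i<n. R i) \<union> R n)"
    by (rule hausdorff_outer_Un_separated[OF e(1)]) (use d(2) e(2) order_trans in blast)
  also have "(\<Union>i<n. R i) \<union> R n = (\<Union>i<Suc n. R i)" by (auto simp: less_Suc_eq)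
  finally show ?case .
qed simp

text \<open>
  Caratheodory's criterion for metric outer measures. The set \<open>D n\<close> of the points of \<open>T\<close> at distance
  at least \<open>1 / (n + 1)\<close> from \<open>F\<close> is separated from \<open>F\<close>, so the required inequality holds with
  \<open>D n\<close> in the place of \<open>T - F\<close>. What is left of \<open>T - F\<close> is a union of shells \<open>R i\<close>. Shells whose indices differ by at
  least two are separated from each other, so the even and the odd ones each have total measure at
  most that of \<open>T\<close>; the shells thus form a convergent series, whose tails bound the error of
  replacing \<open>T - F\<close> by \<open>D n\<close>.
\<close>

lemma closed_in_lambda_system_hausdorff:
  fixes F :: "'a::metric_space set"
  assumes "closed F"
  shows "F \<in> lambda_system UNIV UNIV (hausdorff_outer k)"
proof -
  let ?H = "hausdorff_outer k :: 'a set \<Rightarrow> ennreal"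
  have le: "?H (F \<inter> T) + ?H (T - F) \<le> ?H T" for T
  proof (cases "F = {} \<or> ?H T = top")
    case True
    then show ?thesis by (auto simp: hausdorff_outer_empty)
  next
    case False
    then have ne: "F \<noteq> {}" and fin: "?H T < top" by (auto simp: less_top)
    define D where "D n = {x \<in> T. 1 / real (Suc n) \<le> infdist x F}" for n
    define R where "R n = {x \<in> T. infdist x F < 1 / real (Suc n) \<and> 1 / real (Suc (Suc n)) \<le> infdist x F}" for n
    have D_dist: "1 / real (Suc n) \<le> dist x y" if "x \<in> F" "y \<in> D n" for x y n
    proof -
      have "infdist y F \<le> dist y x" using that by (intro infdist_le)
      then show ?thesis using that by (simp add: D_def dist_commute)
    qed
    have FD: "?H (F \<inter> T) + ?H (D n) \<le> ?H T" for n
    proof -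
      have "?H (F \<inter> T) + ?H (D n) \<le> ?H ((F \<inter> T) \<union> D n)"
        by (rule hausdorff_outer_Un_separated[of "1 / real (Suc n)"]) (use D_dist in auto)
      also have "\<dots> \<le> ?H T" by (rule hausdorff_outer_mono) (auto simp: D_def)
      finally show ?thesis .
    qed
    have R_sep: "\<exists>d>0. \<forall>x\<in>R i. \<forall>y\<in>R j. d \<le> dist x y" if "Suc i < j" for i j
    proof (intro exI conjI ballI)
      show "0 < 1 / real (Suc (Suc i)) - 1 / real (Suc j)"
        using that by (simp add: frac_less2)
      fix x y assume xy: "x \<in> R i" "y \<in> R j"
      have "infdist x F \<le> infdist y F + dist x y" by (rule infdist_triangle)
      then show "1 / real (Suc (Suc i)) - 1 / real (Suc j) \<le> dist x y"
        using xy by (simp add: R_def)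
    qed
    \<comment> \<open>The parameter c is 0 for the even and 1 for the odd shells.\<close>
    have half: "(\<Sum>i<n. ?H (R (2 * i + c))) \<le> ?H T" for n c
    proof -
      have "(\<Sum>i<n. ?H (R (2 * i + c))) \<le> ?H (\<Union>i<n. R (2 * i + c))"
        by (rule hausdorff_outer_sum_separated[where R = "\<lambda>i. R (2 * i + c)"]) (rule R_sep, simp)
      also have "\<dots> \<le> ?H T" by (rule hausdorff_outer_mono) (auto simp: R_def)
      finally show ?thesis .
    qed
    have partial: "(\<Sum>i<n. ?H (R i)) \<le> 2 * ?H T" for n
    proof -
      have "(\<Sum>i<n. ?H (R i)) \<le> (\<Sum>i<2 * n. ?H (R i))"
        by (rule sum_mono2) auto
      also have "\<dots> = (\<Sum>i<n. ?H (R (2 * i + 0))) + (\<Sum>i<n. ?H (R (2 * i + 1)))"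
        by (induction n) (auto simp: algebra_simps)
      also have "\<dots> \<le> 2 * ?H T"
        unfolding mult_2[of "?H T"] by (rule add_mono[OF half half])
      finally show ?thesis .
    qed
    have R_fin: "?H (R i) < top" for i
      using hausdorff_outer_mono[of "R i" T k] fin by (auto simp: R_def intro: le_less_trans)
    define a where "a i = enn2real (?H (R i))" for i
    have a: "?H (R i) = ennreal (a i)" "0 \<le> a i" for i
      using R_fin[of i] by (auto simp: a_def)
    have "summable a"
    proof (rule summableI_nonneg_bounded)
      fix n
      have "ennreal (\<Sum>i<n. a i) \<le> 2 * ?H T"
        using partial[of n] by (simp add: a sum_ennreal)
      also have "\<dots> = ennreal (2 * enn2real (?H T))"
        using fin by (simp add: ennreal_mult)
      finally show "(\<Sum>i<n. a i) \<le> 2 * enn2real (?H T)"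
        by (simp add: ennreal_le_iff)
    qed (rule a)
    show ?thesis
    proof (rule ennreal_le_epsilon)
      fix e :: real assume "0 < e"
      from suminf_exist_split[OF this \<open>summable a\<close>] obtain N
        where N: "norm (\<Sum>i. a (i + N)) < e" by blast
      have "T - F \<subseteq> D N \<union> (\<Union>i. R (i + N))"
      proof
        fix x assume x: "x \<in> T - F"
        then have pos: "0 < infdist x F"
          using in_closed_iff_infdist_zero[OF \<open>closed F\<close> ne] infdist_nonneg[of x F]
          by (metis DiffE less_eq_real_def)
        show "x \<in> D N \<union> (\<Union>i. R (i + N))"
        proof (cases "x \<in> D N")
          case False
          then have lt: "infdist x F < 1 / real (Suc N)" using x by (auto simp: D_def)
          define P where "P m \<longleftrightarrow> 1 / real (Suc m) \<le> infdist x F" for m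
          obtain m where "P m"
            using pos reals_Archimedean unfolding P_def by (metis inverse_eq_divide less_imp_le)
          define l where "l = (LEAST m. P m)"
          have l: "P l" using \<open>P m\<close> unfolding l_def by (rule LeastI)
          have "N < l"
          proof (rule ccontr)
            assume "\<not> N < l"
            then have "1 / real (Suc N) \<le> 1 / real (Suc l)" by (simp add: frac_le)
            then show False using l lt unfolding P_def by linarith
          qed
          then obtain i where i: "l = Suc (i + N)" by (metis add.commute less_iff_Suc_add)
          have "\<not> P (i + N)" using not_less_Least[of "i + N" P] i by (simp add: l_def)
          then have "x \<in> R (i + N)" using l x unfolding R_def P_def i by auto
          then show ?thesis by blast
        qed simp
      qed
      then have "?H (T - F) \<le> ?H (D N \<union> (\<Union>i. R (i + N)))" by (rule hausdorff_outer_mono)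
      also have "\<dots> \<le> ?H (D N) + ?H (\<Union>i. R (i + N))" by (rule hausdorff_outer_Un_le)
      also have "?H (\<Union>i. R (i + N)) \<le> (\<Sum>i. ?H (R (i + N)))" by (rule hausdorff_outer_UN_le)
      also have "(\<Sum>i. ?H (R (i + N))) = ennreal (\<Sum>i. a (i + N))"
        unfolding a using \<open>summable a\<close> a by (intro suminf_ennreal2) auto
      also have "\<dots> \<le> ennreal e" using N by (intro ennreal_leI) auto
      finally have "?H (T - F) \<le> ?H (D N) + ennreal e" by (simp add: add_left_mono)
      then have "?H (F \<inter> T) + ?H (T - F) \<le> ?H (F \<inter> T) + (?H (D N) + ennreal e)" by (rule add_left_mono)
      also have "\<dots> = (?H (F \<inter> T) + ?H (D N)) + ennreal e" by (simp add: add.assoc)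
      also have "\<dots> \<le> ?H T + ennreal e" by (rule add_right_mono) (rule FD)
      finally show "?H (F \<inter> T) + ?H (T - F) \<le> ?H T + ennreal e" .
    qed
  qed
  have ge: "?H T \<le> ?H (F \<inter> T) + ?H (T - F)" for T
  proof -
    have "(F \<inter> T) \<union> (T - F) = T" by blast
    then show ?thesis using hausdorff_outer_Un_le[of k "F \<inter> T" "T - F"] by metis
  qed
  have "?H (F \<inter> T) + ?H ((UNIV - F) \<inter> T) = ?H T" for T
  proof -
    have "(UNIV - F) \<inter> T = T - F" by blast
    then show ?thesis using le ge by (simp add: antisym)
  qed
  then show ?thesis unfolding lambda_system_def by blast
qed

text \<open>
  The definition through \<^const>\<open>measure_of\<close> yields the intended values only because the outer measure
  is countably additive on Borel sets.
\<close>

lemma emeasure_hausdorff_measure: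
  assumes "A \<in> sets borel"
  shows "emeasure (hausdorff_measure k) A = hausdorff_outer k A"
proof -
  let ?L = "lambda_system UNIV UNIV (hausdorff_outer k :: 'a::metric_space set \<Rightarrow> ennreal)"
  have ms: "measure_space UNIV ?L (hausdorff_outer k)"
    using sigma_algebra.caratheodory_lemma[OF sigma_algebra_Pow[of "UNIV :: 'a set"],
        of "hausdorff_outer k"] outer_measure_space_hausdorff_outer[of k] by simp
  then interpret L: sigma_algebra UNIV ?L by (simp add: measure_space_def)
  have "sigma_sets UNIV (Collect closed) \<subseteq> ?L"
    by (rule L.sigma_sets_subset) (use closed_in_lambda_system_hausdorff in blast)
  then have "sets borel \<subseteq> ?L"
    by (simp add: borel_eq_closed sets_measure_of)
  then have "measure_space UNIV (sets borel) (hausdorff_outer k :: 'a set \<Rightarrow> ennreal)"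
    using measure_down[OF ms] sets.sigma_algebra_axioms[of "borel :: 'a measure"] by simp
  then show ?thesis
    using assms unfolding hausdorff_measure_def measure_space_def
    by (intro emeasure_measure_of_sigma) auto
qed

lemma sets_hausdorff_measure [simp, measurable_cong]: "sets (hausdorff_measure k) = sets borel"
  unfolding hausdorff_measure_def
  using sets.sigma_sets_eq[of borel] by (simp add: sets_measure_of_conv)

lemma space_hausdorff_measure [simp]: "space (hausdorff_measure k) = UNIV"
  unfolding hausdorff_measure_def by (simp add: space_measure_of_conv)

section \<open>Hausdorff measure of the sphere\<close>

lemma power_shell_le:
  fixes h :: real
  assumes "0 \<le> h" "h \<le> 1"
  shows "(1 + h) ^ n - (1 - h) ^ n \<le> h * real n * 2 ^ n"
proof (induction n)
  case (Suc n)
  have 1: "(1 + h) * ((1 + h) ^ n - (1 - h) ^ n) \<le> 2 * (h * real n * 2 ^ n)"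
    using assms Suc by (intro mult_mono) (auto intro!: power_mono)
  have "(1 - h) ^ n \<le> 1" "(1::real) \<le> 2 ^ n"
    using assms by (auto intro: power_le_one)
  then have 2: "2 * h * (1 - h) ^ n \<le> 2 * h * 2 ^ n"
    using assms by (intro mult_left_mono) (linarith, simp)
  have "(1 + h) ^ Suc n - (1 - h) ^ Suc n
      = (1 + h) * ((1 + h) ^ n - (1 - h) ^ n) + 2 * h * (1 - h) ^ n"
    by (simp add: algebra_simps)
  also have "\<dots> \<le> h * real (Suc n) * 2 ^ Suc n"
    using 1 2 by (simp add: algebra_simps)
  finally show ?case .
qed simp

text \<open>
  The balls of radius \<open>h\<close> about the points of \<open>T\<close> are disjoint and lie in the shell between the radii
  \<open>1 - h\<close> and \<open>1 + h\<close>, whose volume is of the order of \<open>h\<close>. So there are at most of the order of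
  \<open>h\<close> to the power \<open>1 - DIM('a)\<close> points.
\<close>

lemma card_separated_sphere_le:
  fixes T :: "'a::euclidean_space set"
  assumes h: "0 < h" "h \<le> 1" and T: "finite T" "T \<subseteq> sphere 0 1"
    and sep: "\<And>x y. x \<in> T \<Longrightarrow> y \<in> T \<Longrightarrow> x \<noteq> y \<Longrightarrow> 2 * h \<le> dist x y"
  shows "real (card T) * h ^ (DIM('a) - 1) \<le> real DIM('a) * 2 ^ DIM('a)"
proof -
  let ?n = "DIM('a)"
  let ?\<omega> = "unit_ball_vol (real ?n)"
  have disj: "disjoint_family_on (\<lambda>t. ball t h) T"
  proof (clarsimp simp: disjoint_family_on_def)
    fix x y assume xy: "x \<in> T" "y \<in> T" "x \<noteq> y"
    then have "2 * h \<le> dist x y" by (rule sep)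
    then show "ball x h \<inter> ball y h = {}"
      by (intro disjoint_ballI) simp
  qed
  have balls: "ball c r \<in> fmeasurable lborel" "cball c r \<in> fmeasurable lborel" for c :: 'a and r
    using emeasure_bounded_finite[of "ball c r"] emeasure_bounded_finite[of "cball c r"]
    by (auto intro!: fmeasurableI)
  have "(\<Union>t\<in>T. ball t h) \<subseteq> ball 0 (1 + h) - cball 0 (1 - h)"
  proof clarify
    fix t x assume t: "t \<in> T" and x: "x \<in> ball t h"
    have "norm t = 1" using t T by auto
    moreover have "\<bar>norm t - norm x\<bar> < h"
      using x norm_triangle_ineq3[of t x] by (simp add: dist_norm)
    ultimately show "x \<in> ball 0 (1 + h) - cball 0 (1 - h)" by auto
  qed
  moreover have "open (\<Union>t\<in>T. ball t h)" by auto
  ultimately have "measure lborel (\<Union>t\<in>T. ball t h) \<le> measure lborel (ball 0 (1 + h) - cball (0::'a) (1 - h))"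
    by (intro measure_mono_fmeasurable fmeasurable.Diff balls) auto
  also have "\<dots> = ?\<omega> * ((1 + h) ^ ?n - (1 - h) ^ ?n)"
    using h by (subst measurable_measure_Diff[OF balls(1)]) (auto simp: content_ball content_cball algebra_simps)
  also have "\<dots> \<le> ?\<omega> * (h * real ?n * 2 ^ ?n)"
    using h by (intro mult_left_mono power_shell_le) auto
  also have "measure lborel (\<Union>t\<in>T. ball t h) = (\<Sum>t\<in>T. measure lborel (ball t h))"
    using T disj emeasure_bounded_finite[OF bounded_ball]
    by (intro measure_finite_Union) (auto simp: less_top)
  also have "\<dots> = real (card T) * (?\<omega> * h ^ ?n)"
    using h by (simp add: content_ball)
  also have "h ^ ?n = h * h ^ (?n - 1)"
    using power_minus_mult[of ?n h] DIM_positive[where 'a='a] by (simp add: mult.commute)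
  finally have "?\<omega> * h * (real (card T) * h ^ (?n - 1)) \<le> ?\<omega> * h * (real ?n * 2 ^ ?n)"
    by (simp only: mult_ac)
  then show ?thesis
    using h by (simp add: unit_ball_vol_pos)
qed

text \<open>
  A separated set of maximal cardinality is a net: the balls of radius \<open>2 * h\<close> about its points cover
  the sphere. The packing bound makes the resulting sum independent of \<open>h\<close>.
\<close>

lemma hausdorff_content_sphere_le:
  assumes h: "0 < h" "h \<le> 1"
  shows "hausdorff_content (DIM('a) - 1) (4 * h) (sphere (0::'a::euclidean_space) 1)
    \<le> ennreal (unit_ball_vol (real (DIM('a) - 1)) * 2 ^ (DIM('a) - 1) * (real DIM('a) * 2 ^ DIM('a)))"
proof -
  let ?n = "DIM('a)" and ?k = "DIM('a) - 1"
  define P where "P T \<longleftrightarrow> finite T \<and> T \<subseteq> sphere (0::'a) 1 \<and>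
    (\<forall>x\<in>T. \<forall>y\<in>T. x \<noteq> y \<longrightarrow> 2 * h \<le> dist x y)" for T
  have bound: "real (card T) * h ^ ?k \<le> real ?n * 2 ^ ?n" if "P T" for T
    using that h by (intro card_separated_sphere_le) (auto simp: P_def)
  have "card T \<le> nat \<lceil>real ?n * 2 ^ ?n / h ^ ?k\<rceil>" if "P T" for T
  proof -
    have "real (card T) \<le> real ?n * 2 ^ ?n / h ^ ?k"
      using bound[OF that] h by (simp add: pos_le_divide_eq)
    then show ?thesis by linarith
  qed
  moreover have "P {}" by (simp add: P_def)
  ultimately obtain T where T: "P T" and max: "\<And>T'. P T' \<Longrightarrow> card T' \<le> card T"
    using ex_has_greatest_nat[of P "{}" card "Suc (nat \<lceil>real ?n * 2 ^ ?n / h ^ ?k\<rceil>)"]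
    by (auto simp: less_Suc_eq_le)
  have fin: "finite T" using T by (simp add: P_def)
  have cover: "sphere 0 1 \<subseteq> (\<Union>t\<in>T. cball t (2 * h))"
  proof
    fix u :: 'a assume u: "u \<in> sphere 0 1"
    show "u \<in> (\<Union>t\<in>T. cball t (2 * h))"
    proof (rule ccontr)
      assume "\<not> ?thesis"
      then have far: "2 * h < dist t u" if "t \<in> T" for t using that by auto
      then have "u \<notin> T" using h by fastforce
      have "P (insert u T)"
        using T u far unfolding P_def by (auto simp: dist_commute less_imp_le)
      from max[OF this] show False using \<open>u \<notin> T\<close> fin by simp
    qed
  qed
  obtain f where f: "bij_betw f {0..<card T} T"
    using ex_bij_betw_nat_finite[OF fin] by blast
  define U where "U i = (if i < card T then cball (f i) (2 * h) else {})" for i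
  have "fine_cover (4 * h) (sphere 0 1) U"
    unfolding fine_cover_def
  proof (intro conjI allI)
    show "sphere 0 1 \<subseteq> (\<Union>i. U i)"
    proof
      fix u :: 'a assume "u \<in> sphere 0 1"
      then obtain t where "t \<in> T" "u \<in> cball t (2 * h)" using cover by blast
      moreover obtain i where "i < card T" "f i = t"
        using f \<open>t \<in> T\<close> by (metis bij_betw_iff_bijections atLeastLessThan_iff)
      ultimately have "u \<in> U i" by (simp add: U_def)
      then show "u \<in> (\<Union>i. U i)" by blast
    qed
  qed (use h in \<open>auto simp: U_def\<close>)
  then have "hausdorff_content ?k (4 * h) (sphere (0::'a) 1) \<le> (\<Sum>i. diam_weight ?k (U i))"
    by (rule hausdorff_content_le)
  also have "\<dots> = (\<Sum>i<card T. diam_weight ?k (U i))"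
    by (rule suminf_finite) (auto simp: U_def diam_weight_def)
  also have "\<dots> = (\<Sum>i<card T. ennreal (unit_ball_vol (real ?k) * (2 * h) ^ ?k))"
    using h by (intro sum.cong) (auto simp: U_def diam_weight_def)
  also have "\<dots> = ennreal (unit_ball_vol (real ?k) * 2 ^ ?k * (real (card T) * h ^ ?k))"
    using h by (simp add: ennreal_of_nat_eq_real_of_nat ennreal_mult[symmetric] power_mult_distrib mult_ac)
  also have "\<dots> \<le> ennreal (unit_ball_vol (real ?k) * 2 ^ ?k * (real ?n * 2 ^ ?n))"
    by (intro ennreal_leI mult_left_mono bound[OF T]) auto
  finally show ?thesis .
qed

lemma hausdorff_outer_sphere_finite:
  "hausdorff_outer (DIM('a) - 1) (sphere (0::'a::euclidean_space) 1) < top"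
proof -
  let ?C = "ennreal (unit_ball_vol (real (DIM('a) - 1)) * 2 ^ (DIM('a) - 1) * (real DIM('a) * 2 ^ DIM('a)))"
  have "hausdorff_outer (DIM('a) - 1) (sphere (0::'a) 1) \<le> ?C"
    unfolding hausdorff_outer_def
  proof (rule SUP_least)
    fix \<delta> :: real assume \<delta>: "\<delta> \<in> {0<..}"
    define h where "h = min (\<delta> / 4) 1"
    have h: "0 < h" "h \<le> 1" "4 * h \<le> \<delta>" using \<delta> by (auto simp: h_def)
    have "hausdorff_content (DIM('a) - 1) \<delta> (sphere (0::'a) 1)
        \<le> hausdorff_content (DIM('a) - 1) (4 * h) (sphere (0::'a) 1)"
      by (rule hausdorff_content_mono) (use h in auto)
    also have "\<dots> \<le> ?C" by (rule hausdorff_content_sphere_le) (use h in auto)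
    finally show "hausdorff_content (DIM('a) - 1) \<delta> (sphere (0::'a) 1) \<le> ?C" .
  qed
  then show ?thesis by (rule le_less_trans) simp
qed

text \<open>
  The cone over a ball of radius \<open>d\<close> about a point \<open>p\<close> of the sphere lies in the tube of radius
  \<open>2 * d\<close> about the segment from \<open>0\<close> to \<open>p\<close>, which about \<open>1 / d\<close> balls cover. This compares the volume
  of cones with the weight that Hausdorff measure of codimension one gives to a set of diameter \<open>d\<close>.
\<close>

lemma cone_cover_volume:
  fixes p :: "'a::euclidean_space"
  assumes n: "2 \<le> DIM('a)" and p: "norm p = 1" and d: "0 \<le> d" "d \<le> 1"
  shows "\<exists>B\<in>sets borel. {s *\<^sub>R v |s v. 0 \<le> s \<and> s \<le> 1 \<and> dist p v \<le> d} \<subseteq> B \<and>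
    emeasure lborel B \<le> ennreal (3 * unit_ball_vol (real DIM('a)) * 2 ^ DIM('a) * d ^ (DIM('a) - 1))"
proof (cases "d = 0")
  case True
  \<comment> \<open>For d = 0 the cone is a segment, which is a null set as the dimension is at least 2.\<close>
  have "dim (span {p}) < DIM('a)"
    using dim_le_card[of "{p}" "{p}"] n by (simp add: dim_span span_superset)
  then have "negligible (span {p})" by (rule negligible_lowdim)
  then have "emeasure lborel (span {p}) = 0"
    by (simp add: negligible_iff_emeasure0 closed_subspace borel_closed)
  then show ?thesis
    using True by (intro bexI[of _ "span {p}"])
      (auto simp: borel_closed closed_subspace span_base span_scale)
next
  case False
  let ?n = "DIM('a)"
  let ?\<omega> = "unit_ball_vol (real ?n)"
  define N where "N = nat \<lceil>1 / d\<rceil>"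
  have dpos: "0 < d" using False d by simp
  have N: "1 / d \<le> real N" "real N \<le> 1 / d + 1" "0 < N"
    using dpos unfolding N_def by (simp_all add: real_nat_ceiling_ge of_nat_ceiling)
  define B where "B = (\<Union>j\<in>{..N}. cball ((real j / real N) *\<^sub>R p) (2 * d))"
  have Bsets: "B \<in> sets borel" unfolding B_def by (intro borel_closed closed_UN) auto
  have "s *\<^sub>R v \<in> B" if s: "0 \<le> s" "s \<le> 1" and v: "dist p v \<le> d" for s v
  proof -
    define j where "j = nat \<lfloor>s * real N\<rfloor>"
    have j: "real j \<le> s * real N" "s * real N < real j + 1" using s unfolding j_def by simp linarith
    have "s * real N \<le> 1 * real N" using s by (intro mult_right_mono) auto
    then have "j \<le> N" using j by linarith
    have "\<bar>s - real j / real N\<bar> = (s * real N - real j) / real N"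
      using j N by (simp add: field_simps)
    also have "\<dots> \<le> 1 / real N" using j by (intro divide_right_mono) auto
    also have "\<dots> \<le> d" using N dpos by (simp add: field_simps)
    finally have sj: "\<bar>s - real j / real N\<bar> \<le> d" .
    have "dist ((real j / real N) *\<^sub>R p) (s *\<^sub>R v) = norm (s *\<^sub>R (v - p) + (s - real j / real N) *\<^sub>R p)"
      by (simp add: dist_norm norm_minus_commute algebra_simps)
    also have "\<dots> \<le> s * norm (v - p) + \<bar>s - real j / real N\<bar>"
      using s p by (intro order_trans[OF norm_triangle_ineq]) simp
    also have "\<dots> \<le> 1 * d + d"
      using s v sj by (intro add_mono mult_mono) (auto simp: dist_norm norm_minus_commute)
    finally show ?thesis using \<open>j \<le> N\<close> unfolding B_def by auto
  qed
  moreover have "emeasure lborel B \<le> ennreal (3 * ?\<omega> * 2 ^ ?n * d ^ (?n - 1))"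
  proof -
    have "emeasure lborel B \<le> (\<Sum>j\<in>{..N}. emeasure lborel (cball ((real j / real N) *\<^sub>R p) (2 * d)))"
      unfolding B_def by (rule emeasure_subadditive_finite) auto
    also have "\<dots> = ennreal (real (Suc N) * (?\<omega> * (2 * d) ^ ?n))"
      using d by (simp add: emeasure_cball ennreal_of_nat_eq_real_of_nat ennreal_mult[symmetric] del: of_nat_Suc)
    also have "real (Suc N) * (?\<omega> * (2 * d) ^ ?n) \<le> 3 / d * (?\<omega> * (2 * d) ^ ?n)"
    proof (rule mult_right_mono)
      have "1 \<le> 1 / d" using dpos d by simp
      then show "real (Suc N) \<le> 3 / d" using N by simp
    qed (use d in auto)
    also have "\<dots> = 3 * ?\<omega> * 2 ^ ?n * d ^ (?n - 1)"
      using power_minus_mult[of ?n d] DIM_positive[where 'a='a] dpos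
      by (simp add: power_mult_distrib field_simps)
    finally show ?thesis by (simp add: ennreal_leI)
  qed
  ultimately show ?thesis using Bsets by (intro bexI[of _ B]) auto
qed

text \<open>
  A cover of the open piece of the sphere yields a cover of the cone over this piece. The cone contains
  an open set \<open>Q\<close> of positive volume, and the volume of \<open>Q\<close> is at most a constant times the sum of the weights
  of the cover.
\<close>

lemma hausdorff_outer_sphere_open_pos:
  fixes W :: "'a::euclidean_space set"
  assumes n: "2 \<le> DIM('a)" and W: "open W" "sphere 0 1 \<inter> W \<noteq> {}"
  shows "0 < hausdorff_outer (DIM('a) - 1) (sphere 0 1 \<inter> W)"
proof -
  let ?n = "DIM('a)" and ?k = "DIM('a) - 1"
  let ?V = "sphere 0 1 \<inter> W"
  define C where "C = 3 * unit_ball_vol (real ?n) * 2 ^ ?n * 2 ^ ?k / unit_ball_vol (real ?k)"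
  have \<omega>: "0 < unit_ball_vol (real ?n)" "0 < unit_ball_vol (real ?k)" by simp_all
  then have C: "0 < C" by (simp add: C_def)
  define Q where "Q = ((\<lambda>x::'a. x /\<^sub>R norm x) -` W \<inter> - {0}) \<inter> ball 0 1"
  have "continuous_on (- {0}) (\<lambda>x::'a. x /\<^sub>R norm x)"
    by (auto intro!: continuous_intros)
  then have "open ((\<lambda>x::'a. x /\<^sub>R norm x) -` W \<inter> - {0})"
    using W(1) continuous_on_open_vimage[of "- {0::'a}"] by blast
  then have "open Q" unfolding Q_def by auto
  obtain u where u: "u \<in> ?V" using W by blast
  then have "(1/2) *\<^sub>R u \<in> Q" by (auto simp: Q_def)
  with \<open>open Q\<close> have Q_pos: "0 < emeasure lborel Q"
    using open_not_negligible[of Q] by (auto simp: negligible_iff_emeasure0 zero_less_iff_neq_zero)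
  \<comment> \<open>C converts the weight of a set into the volume bound for the cone over it.\<close>
  have "emeasure lborel Q * ennreal (1 / C) \<le> hausdorff_content ?k 1 ?V"
  proof (rule le_hausdorff_content)
    fix U assume U: "fine_cover 1 ?V U"
    let ?cone = "\<lambda>i. {s *\<^sub>R v |s v. 0 \<le> s \<and> s \<le> 1 \<and> v \<in> U i \<inter> ?V}"
    have "\<exists>B. B \<in> sets borel \<and> ?cone i \<subseteq> B \<and>
        emeasure lborel B \<le> ennreal C * diam_weight ?k (U i)" for i
    proof (cases "U i \<inter> ?V = {}")
      case False
      then obtain p where p: "p \<in> U i" "norm p = 1" by auto
      have bdd: "bounded (U i)" and dia: "diameter (U i) \<le> 1" "0 \<le> diameter (U i)"
        using U by (auto simp: fine_cover_def diameter_ge_0)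
      obtain B where B: "B \<in> sets borel" "{s *\<^sub>R v |s v. 0 \<le> s \<and> s \<le> 1 \<and> dist p v \<le> diameter (U i)} \<subseteq> B"
        "emeasure lborel B \<le> ennreal (3 * unit_ball_vol (real ?n) * 2 ^ ?n * diameter (U i) ^ ?k)"
        using cone_cover_volume[OF n p(2) dia(2,1)] by blast
      have "a * x = a * c / w * (w * (x / c))" if "0 < w" "0 < c" for a c w x :: real
        using that by simp
      note scale = this
      have "3 * unit_ball_vol (real ?n) * 2 ^ ?n * diameter (U i) ^ ?k
          = C * (unit_ball_vol (real ?k) * (diameter (U i) / 2) ^ ?k)"
        unfolding C_def power_divide by (rule scale[OF \<omega>(2)]) simp
      then have "emeasure lborel B \<le> ennreal C * diam_weight ?k (U i)"
        using B(3) C p dia by (auto simp: diam_weight_def ennreal_mult[symmetric])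
      moreover have "?cone i \<subseteq> B"
        using B(2) diameter_bounded_bound[OF bdd p(1)] by fast
      ultimately show ?thesis using B(1) by blast
    next
      case True
      then have "?cone i = {}" by blast
      then show ?thesis by (intro exI[of _ "{}"]) simp
    qed
    then have "\<forall>i. \<exists>B. B \<in> sets borel \<and> ?cone i \<subseteq> B \<and>
        emeasure lborel B \<le> ennreal C * diam_weight ?k (U i)" by (rule allI)
    from choice[OF this] obtain B where B: "\<And>i. B i \<in> sets borel" "\<And>i. ?cone i \<subseteq> B i"
      "\<And>i. emeasure lborel (B i) \<le> ennreal C * diam_weight ?k (U i)"
      by iprover
    have "Q \<subseteq> (\<Union>i. B i)"
    proof
      fix x assume x: "x \<in> Q"
      define v where "v = x /\<^sub>R norm x"
      have x_v: "x = norm x *\<^sub>R v" "norm x \<le> 1" "v \<in> ?V" using x by (auto simp: Q_def v_def)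
      then obtain i where "v \<in> U i" using U by (auto simp: fine_cover_def)
      then have "x \<in> ?cone i"
        using x_v norm_ge_zero by blast
      then show "x \<in> (\<Union>i. B i)" using B(2) by blast
    qed
    then have "emeasure lborel Q \<le> emeasure lborel (\<Union>i. B i)"
      using B(1) by (intro emeasure_mono) auto
    also have "\<dots> \<le> (\<Sum>i. emeasure lborel (B i))"
      using B(1) by (intro emeasure_subadditive_countably) auto
    also have "\<dots> \<le> (\<Sum>i. ennreal C * diam_weight ?k (U i))"
      by (intro suminf_le B(3)) auto
    finally have "emeasure lborel Q \<le> ennreal C * (\<Sum>i. diam_weight ?k (U i))" by simp
    from mult_right_mono[OF this, of "ennreal (1 / C)"]
    have "emeasure lborel Q * ennreal (1 / C) \<le> (\<Sum>i. diam_weight ?k (U i)) * (ennreal C * ennreal (1 / C))"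
      by (simp only: mult_ac zero_le)
    also have "ennreal C * ennreal (1 / C) = 1"
      using C by (simp add: ennreal_mult[symmetric])
    finally show "emeasure lborel Q * ennreal (1 / C) \<le> (\<Sum>i. diam_weight ?k (U i))" by simp
  qed
  also have "\<dots> \<le> hausdorff_outer ?k ?V" by (rule hausdorff_content_le_outer) simp
  finally have "emeasure lborel Q * ennreal (1 / C) \<le> hausdorff_outer ?k ?V" .
  moreover have "0 < emeasure lborel Q * ennreal (1 / C)"
    using Q_pos C by (simp add: ennreal_zero_less_mult_iff)
  ultimately show ?thesis by (rule less_le_trans[rotated])
qed

definition sphere_measure :: "'a::euclidean_space measure" where
  "sphere_measure = restrict_space (hausdorff_measure (DIM('a) - 1)) (sphere 0 1)"

lemma space_sphere_measure [simp]: "space sphere_measure = sphere 0 1"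
  by (simp add: sphere_measure_def space_restrict_space)

lemma sets_sphere_measure: "sets sphere_measure = sets (restrict_space borel (sphere 0 1))"
  unfolding sphere_measure_def by (rule sets_restrict_space_cong) simp

lemma emeasure_sphere_measure:
  fixes A :: "'a::euclidean_space set"
  assumes "A \<in> sets borel" "A \<subseteq> sphere 0 1"
  shows "emeasure sphere_measure A = hausdorff_outer (DIM('a) - 1) A"
  unfolding sphere_measure_def
  using assms by (simp add: emeasure_restrict_space emeasure_hausdorff_measure)

text \<open>
  Finiteness makes all continuous functions integrable, and the following positivity for nonempty open
  sets turns equality in an integral inequality into pointwise equality of continuous functions. The
  proof of the main result uses nothing else about the measure.
\<close>

lemma finite_sphere_measure: "finite_measure (sphere_measure :: 'a::euclidean_space measure)"
  using hausdorff_outer_sphere_finite[where 'a='a]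
  by (intro finite_measureI) (simp add: emeasure_sphere_measure borel_closed)

lemma integrable_sphere_measure:
  fixes g :: "'a::euclidean_space \<Rightarrow> real"
  assumes "continuous_on (sphere 0 1) g"
  shows "integrable sphere_measure g"
proof -
  interpret finite_measure "sphere_measure :: 'a measure" by (rule finite_sphere_measure)
  have "bounded (g ` sphere 0 1)"
    using assms by (intro compact_imp_bounded compact_continuous_image) auto
  then obtain b where b: "\<And>u. u \<in> sphere 0 1 \<Longrightarrow> norm (g u) \<le> b"
    unfolding bounded_iff by blast
  have "g \<in> borel_measurable (restrict_space borel (sphere 0 1))"
    using assms by (rule borel_measurable_continuous_on_restrict)
  then have "g \<in> borel_measurable sphere_measure"
    by (simp add: sets_sphere_measure cong: measurable_cong_sets)
  then show ?thesis
    by (intro integrable_const_bound[of _ b] AE_I2) (use b in auto)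
qed

lemma integral_sphere_measure_pos:
  fixes g :: "'a::euclidean_space \<Rightarrow> real"
  assumes n: "2 \<le> DIM('a)" and g: "continuous_on (sphere 0 1) g"
    and nonneg: "\<And>u. u \<in> sphere 0 1 \<Longrightarrow> 0 \<le> g u" and u0: "u0 \<in> sphere 0 1" "0 < g u0"
  shows "0 < (\<integral>u. g u \<partial>sphere_measure)"
proof (rule ccontr)
  assume "\<not> ?thesis"
  moreover have "0 \<le> (\<integral>u. g u \<partial>sphere_measure)"
    using nonneg by (intro Bochner_Integration.integral_nonneg) auto
  ultimately have "(\<integral>u. g u \<partial>sphere_measure) = 0" by linarith
  moreover have "AE u in sphere_measure. 0 \<le> g u"
    using nonneg by (intro AE_I2) simp
  ultimately have AE: "AE u in sphere_measure. g u = 0"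
    using integral_nonneg_eq_0_iff_AE[OF integrable_sphere_measure[OF g]] by blast
  have "openin (top_of_set (sphere 0 1)) (sphere 0 1 \<inter> g -` {0<..})"
    by (rule continuous_openin_preimage_gen[OF g]) auto
  then obtain W where W: "open W" "sphere 0 1 \<inter> g -` {0<..} = sphere 0 1 \<inter> W"
    unfolding openin_open by auto
  have borel: "sphere 0 1 \<inter> W \<in> sets borel"
    using W(1) by (auto intro!: borel_closed borel_open)
  have "sphere 0 1 \<inter> W = {u \<in> space sphere_measure. \<not> g u \<le> 0}"
    using W(2)[symmetric] by auto
  moreover have "AE u in sphere_measure. g u \<le> 0" using AE by eventually_elim simp
  ultimately have "emeasure sphere_measure (sphere 0 1 \<inter> W) = 0"
    using borel by (subst AE_iff_measurable[symmetric, where P="\<lambda>u. g u \<le> 0"])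
      (auto simp: sets_sphere_measure sets_restrict_space)
  moreover have "0 < hausdorff_outer (DIM('a) - 1) (sphere 0 1 \<inter> W)"
    using n W(1) by (rule hausdorff_outer_sphere_open_pos) (use u0 W(2) in auto)
  ultimately show False
    using borel by (simp add: emeasure_sphere_measure)
qed

lemma dual_volume_eq: "dual_volume G K = (\<integral>u. G (radial K u) u \<partial>sphere_measure)"
  unfolding dual_volume_def set_lebesgue_integral_def sphere_measure_def
  by (subst integral_restrict_space) simp_all

section \<open>Star bodies and their radial functions\<close>

text \<open>
  Along each ray a star body is a segment that contains its end point, by star-shapedness and
  compactness. Hence the radial function determines the body.
\<close>

lemma star_body_scaleR_mem_iff:
  assumes L: "star_body L" and u: "u \<in> sphere 0 1" and t: "0 \<le> t"
  shows "t *\<^sub>R u \<in> L \<longleftrightarrow> t \<le> radial L u"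
proof -
  define A where "A = {t. 0 \<le> t \<and> t *\<^sub>R u \<in> L}"
  have compact: "compact L" and star: "\<And>x. x \<in> L \<Longrightarrow> closed_segment 0 x \<subseteq> L"
    and pos: "0 < radial L u"
    using L u by (auto simp: star_body_def)
  obtain B where B: "\<And>x. x \<in> L \<Longrightarrow> norm x \<le> B"
    using compact_imp_bounded[OF compact] by (auto simp: bounded_iff)
  have "L \<noteq> {}"
  proof
    assume "L = {}"
    then have "radial L u = 0" by (simp add: radial_def)
    with pos show False by simp
  qed
  then have "0 \<in> L" using star by fastforce
  then have A_insert: "A = insert 0 {t. t > 0 \<and> t *\<^sub>R u \<in> L}" by (auto simp: A_def)
  have "closed ({0..} \<inter> (\<lambda>t. t *\<^sub>R u) -` L)"
    by (intro closed_Int closed_atLeast closed_vimage compact_imp_closed[OF compact] continuous_intros)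
  then have "closed A" by (simp add: A_def Int_def vimage_def)
  have bdd: "bdd_above A"
    using B u by (intro bdd_aboveI[of _ B]) (fastforce simp: A_def)
  have "A \<noteq> {}" using A_insert by blast
  have "radial L u = Sup A" by (simp add: radial_def A_insert)
  then have Sup: "radial L u \<in> A"
    using closed_contains_Sup[OF \<open>A \<noteq> {}\<close> bdd \<open>closed A\<close>] by simp
  show ?thesis
  proof
    assume "t *\<^sub>R u \<in> L"
    then have "t \<in> A" using t by (simp add: A_def)
    then show "t \<le> radial L u" unfolding \<open>radial L u = Sup A\<close> using bdd by (rule cSup_upper)
  next
    assume "t \<le> radial L u"
    then have "t *\<^sub>R u = (1 - t / radial L u) *\<^sub>R 0 + (t / radial L u) *\<^sub>R (radial L u *\<^sub>R u)"
      "0 \<le> t / radial L u" "t / radial L u \<le> 1"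
      using pos t by simp_all
    then have "t *\<^sub>R u \<in> closed_segment 0 (radial L u *\<^sub>R u)"
      unfolding in_segment by blast
    then show "t *\<^sub>R u \<in> L" using star Sup by (auto simp: A_def)
  qed
qed

lemma polar_decomposition:
  fixes x :: "'a::euclidean_space"
  obtains t u where "0 \<le> t" "u \<in> sphere 0 1" "x = t *\<^sub>R u"
proof (cases "x = 0")
  case True
  show ?thesis
    by (rule that[of 0 "SOME i. i \<in> Basis"]) (use True SOME_Basis in auto)
next
  case False
  show ?thesis
    by (rule that[of "norm x" "x /\<^sub>R norm x"]) (use False in auto)
qed

lemma dilatatesI:
  fixes K L :: "'a::euclidean_space set"
  assumes K: "star_body K" and L: "star_body L" and c: "0 < c"
    and radial: "\<And>u. u \<in> sphere 0 1 \<Longrightarrow> radial K u = c * radial L u"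
  shows "dilatates K L"
proof -
  have "x \<in> K \<longleftrightarrow> x \<in> (\<lambda>x. c *\<^sub>R x) ` L" for x
  proof -
    obtain t u where x: "0 \<le> t" "u \<in> sphere 0 1" "x = t *\<^sub>R u"
      by (rule polar_decomposition)
    have "x \<in> K \<longleftrightarrow> t \<le> c * radial L u"
      using star_body_scaleR_mem_iff[OF K x(2,1)] radial[OF x(2)] x(3) by simp
    also have "\<dots> \<longleftrightarrow> t / c \<le> radial L u" using c by (simp add: field_simps)
    also have "\<dots> \<longleftrightarrow> (t / c) *\<^sub>R u \<in> L"
      using star_body_scaleR_mem_iff[OF L x(2), of "t / c"] x(1) c by simp
    also have "\<dots> \<longleftrightarrow> x \<in> (\<lambda>x. c *\<^sub>R x) ` L"
    proof
      assume "(t / c) *\<^sub>R u \<in> L"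
      then show "x \<in> (\<lambda>x. c *\<^sub>R x) ` L"
        using c x(3) by (intro image_eqI[of _ _ "(t / c) *\<^sub>R u"]) auto
    next
      assume "x \<in> (\<lambda>x. c *\<^sub>R x) ` L"
      then obtain z where z: "z \<in> L" "x = c *\<^sub>R z" by blast
      have "(t / c) *\<^sub>R u = (1 / c) *\<^sub>R x" using x(3) by simp
      also have "\<dots> = z" using c z(2) by simp
      finally show "(t / c) *\<^sub>R u \<in> L" using z(1) by simp
    qed
    finally show ?thesis .
  qed
  then show ?thesis using c unfolding dilatates_def by blast
qed

lemma star_body_eqI:
  fixes K L :: "'a::euclidean_space set"
  assumes "star_body K" "star_body L" "\<And>u. u \<in> sphere 0 1 \<Longrightarrow> radial K u = radial L u"
  shows "K = L"
proof (rule set_eqI)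
  fix x :: 'a
  obtain t u where x: "0 \<le> t" "u \<in> sphere 0 1" "x = t *\<^sub>R u"
    by (rule polar_decomposition)
  then show "x \<in> K \<longleftrightarrow> x \<in> L"
    using assms by (simp add: star_body_scaleR_mem_iff)
qed

lemma star_body_with_radial:
  fixes r :: "'a::euclidean_space \<Rightarrow> real"
  assumes cont: "continuous_on (sphere 0 1) r" and pos: "\<And>u. u \<in> sphere 0 1 \<Longrightarrow> 0 < r u"
  obtains S where "star_body S" "\<And>u. u \<in> sphere 0 1 \<Longrightarrow> radial S u = r u"
proof
  define S where "S = (\<lambda>(t, u). (t * r u) *\<^sub>R u) ` ({0..1} \<times> sphere 0 1)"
  have mem: "t *\<^sub>R u \<in> S \<longleftrightarrow> t \<le> r u" if u: "u \<in> sphere 0 1" and t: "0 < t" for t u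
  proof
    assume "t *\<^sub>R u \<in> S"
    then obtain s v where s: "0 \<le> s" "s \<le> 1" and v: "v \<in> sphere 0 1" and eq: "t *\<^sub>R u = (s * r v) *\<^sub>R v"
      by (auto simp: S_def)
    have "norm (t *\<^sub>R u) = norm ((s * r v) *\<^sub>R v)" using eq by simp
    then have tv: "t = s * r v" using u v t s pos[OF v] by simp
    have "t *\<^sub>R u = t *\<^sub>R v" using eq tv by simp
    then have "u = v" using t by simp
    have "s * r v \<le> 1 * r v" using s pos[OF v] by (intro mult_right_mono) auto
    then show "t \<le> r u" using tv \<open>u = v\<close> by simp
  next
    assume "t \<le> r u"
    then show "t *\<^sub>R u \<in> S"
      using t u pos[OF u] unfolding S_def by (intro image_eqI[of _ _ "(t / r u, u)"]) auto
  qed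
  show radial: "radial S u = r u" if u: "u \<in> sphere 0 1" for u
  proof -
    have "insert 0 {t. t > 0 \<and> t *\<^sub>R u \<in> S} = {0..r u}"
      using mem[OF u] pos[OF u] by auto
    then show ?thesis using pos[OF u] by (simp add: radial_def)
  qed
  have "compact S"
    unfolding S_def split_def
    by (intro compact_continuous_image compact_Times continuous_intros continuous_on_compose2[OF cont]) auto
  moreover have "closed_segment 0 x \<subseteq> S" if x: "x \<in> S" for x
  proof
    fix y assume "y \<in> closed_segment 0 x"
    then obtain a where a: "0 \<le> a" "a \<le> 1" "y = a *\<^sub>R x" by (auto simp: in_segment)
    obtain t u where t: "0 \<le> t" "t \<le> 1" "u \<in> sphere 0 1" "x = (t * r u) *\<^sub>R u"
      using x by (auto simp: S_def)
    have "y = (\<lambda>(t, u). (t * r u) *\<^sub>R u) (a * t, u)" using a t by simp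
    moreover have "(a * t, u) \<in> {0..1} \<times> sphere 0 1"
      using a t by (auto intro: mult_le_one)
    ultimately show "y \<in> S" unfolding S_def by (rule image_eqI)
  qed
  moreover have "continuous_on (sphere 0 1) (radial S)"
    by (subst continuous_on_cong[OF refl radial]) (auto intro: cont)
  ultimately show "star_body S"
    using radial pos by (simp add: star_body_def)
qed

section \<open>Radial Orlicz sums\<close>

lemma Phi_bar_component_less:
  fixes x y :: "real^'m"
  assumes \<phi>: "\<phi> \<in> Phi_bar" and "\<And>j. 0 \<le> x $ j" "\<And>j. 0 \<le> y $ j"
    and "x $ i < y $ i" "\<And>j. j \<noteq> i \<Longrightarrow> x $ j = y $ j"
  shows "\<phi> x < \<phi> y"
proof -
  have "\<forall>x\<in>nonneg_orthant. \<forall>y\<in>nonneg_orthant. \<forall>j.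
      x $ j < y $ j \<and> (\<forall>i. i \<noteq> j \<longrightarrow> x $ i = y $ i) \<longrightarrow> \<phi> x < \<phi> y"
    using \<phi> by (simp add: Phi_bar_def)
  from this[rule_format, of x y i] assms(2-) show ?thesis by (simp add: nonneg_orthant_def)
qed

text \<open>
  The definition of \<^const>\<open>Phi_bar\<close> gives monotonicity only when one coordinate changes; the
  coordinates are changed one after the other.
\<close>

lemma Phi_bar_mono:
  fixes x y :: "real^'m"
  assumes \<phi>: "\<phi> \<in> Phi_bar" and xy: "\<And>j. 0 \<le> x $ j" "\<And>j. x $ j \<le> y $ j"
  shows "\<phi> x \<le> \<phi> y"
proof -
  have "\<phi> x \<le> \<phi> (\<chi> j. if j \<in> A then y $ j else x $ j)" if "finite A" for A
    using that
  proof induction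
    case empty
    then show ?case by simp
  next
    case (insert i A)
    let ?a = "\<lambda>A. \<chi> j. if j \<in> A then y $ j else x $ j"
    have "\<phi> (?a A) \<le> \<phi> (?a (insert i A))"
    proof (cases "x $ i = y $ i")
      case True
      then have "?a A = ?a (insert i A)" by (auto simp: vec_eq_iff)
      then show ?thesis by simp
    next
      case False
      then have "x $ i < y $ i" using xy(2)[of i] by simp
      then show ?thesis
        using xy insert.hyps order_trans[OF xy]
        by (intro less_imp_le[OF Phi_bar_component_less[OF \<phi>, of _ _ i]]) auto
    qed
    with insert.IH show ?case by linarith
  qed
  moreover have "(\<chi> j. if j \<in> UNIV then y $ j else x $ j) = y" by (simp add: vec_eq_iff)
  ultimately show ?thesis by (metis finite)
qed

lemma Phi_bar_strict_mono:
  fixes x y :: "real^'m"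
  assumes \<phi>: "\<phi> \<in> Phi_bar" and xy: "\<And>j. 0 \<le> x $ j" "\<And>j. x $ j \<le> y $ j" and i: "x $ i < y $ i"
  shows "\<phi> x < \<phi> y"
proof -
  define z where "z = (\<chi> j. if j = i then y $ i else x $ j)"
  have "\<phi> x < \<phi> z"
    using xy i order_trans[OF xy]
    by (intro Phi_bar_component_less[OF \<phi>, of _ _ i]) (auto simp: z_def)
  also have "\<phi> z \<le> \<phi> y"
    using xy order_trans[OF xy] by (intro Phi_bar_mono[OF \<phi>]) (auto simp: z_def)
  finally show ?thesis .
qed

lemma Phi_bar_scale_less:
  fixes x :: "real^'m"
  assumes "\<phi> \<in> Phi_bar" "x \<in> pos_orthant" "0 \<le> s" "s < t"
  shows "\<phi> (s *\<^sub>R x) < \<phi> (t *\<^sub>R x)"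
  using assms(2-)
  by (intro Phi_bar_strict_mono[OF assms(1), of _ _ undefined]) (auto simp: pos_orthant_def less_imp_le
      intro!: mult_right_mono mult_strict_right_mono mult_nonneg_nonneg)

text \<open>
  A coordinate above \<open>1\<close> would put \<open>x\<close> above a canonical basis vector, where \<open>\<phi>\<close> has the value \<open>1\<close>. This
  is how a radial Orlicz sum is compared with its summands.
\<close>

lemma Phi_bar_le_1_imp:
  fixes x :: "real^'m"
  assumes \<phi>: "\<phi> \<in> Phi_bar" and x: "\<And>j. 0 \<le> x $ j" and le: "\<phi> x \<le> 1"
  shows "x $ j \<le> 1"
proof (rule ccontr)
  assume "\<not> x $ j \<le> 1"
  then have "\<phi> (axis j 1) < \<phi> x"
    using x by (intro Phi_bar_strict_mono[OF \<phi>, of _ _ j]) (auto simp: axis_def)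
  then show False using \<phi> le by (simp add: Phi_bar_def)
qed

lemma Phi_bar_continuous_on_ray:
  fixes x :: "real^'m"
  assumes "\<phi> \<in> Phi_bar" "x \<in> pos_orthant"
  shows "continuous_on {0..} (\<lambda>t. \<phi> (t *\<^sub>R x))"
proof -
  have "continuous_on nonneg_orthant \<phi>" using assms by (simp add: Phi_bar_def)
  then show ?thesis
    by (rule continuous_on_compose2)
      (use assms in \<open>auto simp: nonneg_orthant_def pos_orthant_def less_imp_le intro!: continuous_intros\<close>)
qed

lemma Phi_bar_scale_eq_1:
  fixes x :: "real^'m"
  assumes \<phi>: "\<phi> \<in> Phi_bar" and x: "x \<in> pos_orthant"
  shows "\<exists>t>0. \<forall>s\<ge>0. \<phi> (s *\<^sub>R x) = 1 \<longleftrightarrow> s = t"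
proof -
  have "x \<in> nonneg_orthant - {0}"
    using x by (auto simp: nonneg_orthant_def pos_orthant_def less_imp_le)
  then have "filterlim (\<lambda>t. \<phi> (t *\<^sub>R x)) at_top at_top"
    using \<phi> by (simp add: Phi_bar_def)
  then have "eventually (\<lambda>t. 1 \<le> \<phi> (t *\<^sub>R x)) at_top" by (simp add: filterlim_at_top)
  then obtain T where T: "0 \<le> T" "1 \<le> \<phi> (T *\<^sub>R x)"
    by (metis (mono_tags, lifting) eventually_at_top_linorder le_cases)
  have 0: "\<phi> (0 *\<^sub>R x) = 0" using \<phi> by (simp add: Phi_bar_def)
  have "\<exists>t\<ge>0. t \<le> T \<and> \<phi> (t *\<^sub>R x) = 1"
    using 0 T by (intro IVT' continuous_on_subset[OF Phi_bar_continuous_on_ray[OF \<phi> x]]) auto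
  then obtain t where t: "0 \<le> t" "\<phi> (t *\<^sub>R x) = 1" by blast
  have "t \<noteq> 0" using 0 t by auto
  moreover have "s = t" if "0 \<le> s" "\<phi> (s *\<^sub>R x) = 1" for s
    using Phi_bar_scale_less[OF \<phi> x] t that by (metis less_irrefl linorder_neqE)
  ultimately show ?thesis using t by (metis less_le)
qed

text \<open>
  If \<open>0 < a < t u0 < b\<close>, then \<open>\<phi>\<close> is below \<open>1\<close> at \<open>a *\<^sub>R x u0\<close> and above \<open>1\<close> at \<open>b *\<^sub>R x u0\<close>. By
  continuity both strict inequalities persist near \<open>u0\<close>, and monotonicity along rays then keeps \<open>t u\<close>
  between \<open>a\<close> and \<open>b\<close>.
\<close>

lemma Phi_bar_scale_continuous:
  fixes x :: "'a::topological_space \<Rightarrow> real^'m"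
  assumes \<phi>: "\<phi> \<in> Phi_bar" and cont: "continuous_on X x" and x: "\<And>u. u \<in> X \<Longrightarrow> x u \<in> pos_orthant"
    and t: "\<And>u. u \<in> X \<Longrightarrow> 0 < t u" "\<And>u. u \<in> X \<Longrightarrow> \<phi> (t u *\<^sub>R x u) = 1"
  shows "continuous_on X t"
  unfolding continuous_on_def
proof
  fix u0 assume u0: "u0 \<in> X"
  have lim: "((\<lambda>u. \<phi> (a *\<^sub>R x u)) \<longlongrightarrow> \<phi> (a *\<^sub>R x u0)) (at u0 within X)" if "0 < a" for a
  proof -
    have "continuous_on nonneg_orthant \<phi>" using \<phi> by (simp add: Phi_bar_def)
    then have "continuous_on X (\<lambda>u. \<phi> (a *\<^sub>R x u))"
      by (rule continuous_on_compose2)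
        (use x that cont in \<open>auto simp: nonneg_orthant_def pos_orthant_def less_imp_le intro!: continuous_intros\<close>)
    then show ?thesis using u0 by (simp add: continuous_on_def)
  qed
  have X: "eventually (\<lambda>u. u \<in> X) (at u0 within X)" by (simp add: eventually_at_filter)
  show "(t \<longlongrightarrow> t u0) (at u0 within X)"
  proof (rule order_tendstoI)
    fix a assume a: "a < t u0"
    show "eventually (\<lambda>u. a < t u) (at u0 within X)"
    proof (cases "0 < a")
      case True
      have "\<phi> (a *\<^sub>R x u0) < 1"
        using Phi_bar_scale_less[OF \<phi> x[OF u0], of a "t u0"] True a t[OF u0] by simp
      from order_tendstoD(2)[OF lim[OF True] this] X show ?thesis
      proof eventually_elim
        case (elim u)
        then show ?case
          using Phi_bar_scale_less[OF \<phi> x, of u "t u" a] t[of u] by (cases "a = t u") force+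
      qed
    next
      case False
      from X show ?thesis by eventually_elim (use False t(1) in force)
    qed
  next
    fix a assume a: "t u0 < a"
    then have "0 < a" using t(1)[OF u0] by simp
    have "1 < \<phi> (a *\<^sub>R x u0)"
      using Phi_bar_scale_less[OF \<phi> x[OF u0], of "t u0" a] a t[OF u0] by simp
    from order_tendstoD(1)[OF lim[OF \<open>0 < a\<close>] this] X
    show "eventually (\<lambda>u. t u < a) (at u0 within X)"
    proof eventually_elim
      case (elim u)
      then show ?case
        using Phi_bar_scale_less[OF \<phi> x, of u a "t u"] t[of u] \<open>0 < a\<close> by (cases "a = t u") force+
    qed
  qed
qed

lemma Phi_bar_scale_function:
  fixes x :: "'a::topological_space \<Rightarrow> real^'m"
  assumes \<phi>: "\<phi> \<in> Phi_bar" and cont: "continuous_on X x" and x: "\<And>u. u \<in> X \<Longrightarrow> x u \<in> pos_orthant"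
  obtains t where "continuous_on X t" "\<And>u. u \<in> X \<Longrightarrow> 0 < t u"
    "\<And>u s. u \<in> X \<Longrightarrow> 0 \<le> s \<Longrightarrow> \<phi> (s *\<^sub>R x u) = 1 \<longleftrightarrow> s = t u"
proof -
  have "\<forall>u. \<exists>t. u \<in> X \<longrightarrow> 0 < t \<and> (\<forall>s\<ge>0. \<phi> (s *\<^sub>R x u) = 1 \<longleftrightarrow> s = t)"
    using Phi_bar_scale_eq_1[OF \<phi> x] by blast
  from choice[OF this] obtain t where t: "\<And>u. u \<in> X \<Longrightarrow> 0 < t u"
    "\<And>u s. u \<in> X \<Longrightarrow> 0 \<le> s \<Longrightarrow> \<phi> (s *\<^sub>R x u) = 1 \<longleftrightarrow> s = t u" by blast
  moreover have "continuous_on X t"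
    by (rule Phi_bar_scale_continuous[OF \<phi> cont x]) (use t in \<open>auto simp: less_imp_le\<close>)
  ultimately show ?thesis using that by blast
qed

text \<open>
  Dividing the \<open>\<rho> j u\<close> by \<open>s\<close> moves along a ray: for \<open>\<phi> \<in> Phi_bar\<close> with parameter \<open>1 / s\<close> in the direction
  of the \<open>\<rho> j u\<close>, for \<open>\<phi> \<in> Psi\<close>, after the inversion, with parameter \<open>s\<close> in the direction of the
  \<open>1 / \<rho> j u\<close>.
\<close>

lemma orlicz_radius:
  fixes \<rho> :: "'m::finite \<Rightarrow> 'a::topological_space \<Rightarrow> real"
  assumes \<phi>: "\<phi> \<in> Phi_bar \<union> Psi" and cont: "\<And>j. continuous_on X (\<rho> j)"
    and pos: "\<And>j u. u \<in> X \<Longrightarrow> 0 < \<rho> j u"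
  obtains r where "continuous_on X r" "\<And>u. u \<in> X \<Longrightarrow> 0 < r u"
    "\<And>u s. u \<in> X \<Longrightarrow> 0 < s \<Longrightarrow> \<phi> (\<chi> j. \<rho> j u / s) = 1 \<longleftrightarrow> s = r u"
proof (cases "\<phi> \<in> Phi_bar")
  case True
  obtain t where t: "continuous_on X t" "\<And>u. u \<in> X \<Longrightarrow> 0 < t u"
    "\<And>u s. u \<in> X \<Longrightarrow> 0 \<le> s \<Longrightarrow> \<phi> (s *\<^sub>R (\<chi> j. \<rho> j u)) = 1 \<longleftrightarrow> s = t u"
    by (rule Phi_bar_scale_function[OF True, of X "\<lambda>u. \<chi> j. \<rho> j u"])
      (use cont pos in \<open>auto simp: pos_orthant_def intro!: continuous_intros\<close>)
  show ?thesis
  proof (rule that)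
    show "continuous_on X (\<lambda>u. 1 / t u)"
      using t(1,2) by (intro continuous_intros) force+
    show "0 < 1 / t u" if "u \<in> X" for u using t(2)[OF that] by simp
    show "\<phi> (\<chi> j. \<rho> j u / s) = 1 \<longleftrightarrow> s = 1 / t u" if u: "u \<in> X" and s: "0 < s" for u s
    proof -
      have "(\<chi> j. \<rho> j u / s) = (1 / s) *\<^sub>R (\<chi> j. \<rho> j u)" by (simp add: vec_eq_iff)
      then show ?thesis using t(3)[OF u, of "1 / s"] t(2)[OF u] s by (auto simp: field_simps)
    qed
  qed
next
  case False
  then obtain \<phi>0 where \<phi>0: "\<phi>0 \<in> Phi_bar" "\<And>x. x \<in> pos_orthant \<Longrightarrow> \<phi> x = \<phi>0 (\<chi> j. 1 / x $ j)"
    using \<phi> by (auto simp: Psi_def)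
  have "\<forall>u\<in>X. \<rho> j u \<noteq> 0" for j using pos by (metis less_irrefl)
  then have inv_cont: "continuous_on X (\<lambda>u. \<chi> j. 1 / \<rho> j u)"
    by (intro continuous_intros cont)
  have inv_pos: "(\<chi> j. 1 / \<rho> j u) \<in> pos_orthant" if "u \<in> X" for u
    using pos[OF that] by (simp add: pos_orthant_def)
  obtain t where t: "continuous_on X t" "\<And>u. u \<in> X \<Longrightarrow> 0 < t u"
    "\<And>u s. u \<in> X \<Longrightarrow> 0 \<le> s \<Longrightarrow> \<phi>0 (s *\<^sub>R (\<chi> j. 1 / \<rho> j u)) = 1 \<longleftrightarrow> s = t u"
    by (rule Phi_bar_scale_function[OF \<phi>0(1) inv_cont inv_pos]) auto
  show ?thesis
  proof (rule that[OF t(1,2)])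
    show "\<phi> (\<chi> j. \<rho> j u / s) = 1 \<longleftrightarrow> s = t u" if u: "u \<in> X" and s: "0 < s" for u s
    proof -
      have "(\<chi> j. \<rho> j u / s) \<in> pos_orthant"
        using u s pos by (simp add: pos_orthant_def)
      then have "\<phi> (\<chi> j. \<rho> j u / s) = \<phi>0 (\<chi> j. 1 / ((\<chi> j. \<rho> j u / s) $ j))"
        by (rule \<phi>0(2))
      also have "(\<chi> j. 1 / ((\<chi> j. \<rho> j u / s) $ j)) = s *\<^sub>R (\<chi> j. 1 / \<rho> j u)" by (simp add: vec_eq_iff)
      finally show ?thesis using t(3)[OF u, of s] s by simp
    qed
  qed
qed

text \<open>
  Existence and uniqueness of the radial Orlicz sum, without which the definite description in its
  definition would not denote it.
\<close>

lemma radial_orlicz_sum_props: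
  fixes K :: "'m::finite \<Rightarrow> (real^'n) set"
  assumes \<phi>: "\<phi> \<in> Phi_bar \<union> Psi" and K: "\<And>j. star_body (K j)"
  shows "star_body (radial_orlicz_sum \<phi> K)"
    and "\<And>u. u \<in> sphere 0 1 \<Longrightarrow> \<phi> (\<chi> j. radial (K j) u / radial (radial_orlicz_sum \<phi> K) u) = 1"
proof -
  obtain r where r: "continuous_on (sphere (0::real^'n) 1) r" "\<And>u. u \<in> sphere 0 1 \<Longrightarrow> 0 < r u"
    "\<And>u s. u \<in> sphere 0 1 \<Longrightarrow> 0 < s \<Longrightarrow> \<phi> (\<chi> j. radial (K j) u / s) = 1 \<longleftrightarrow> s = r u"
    by (rule orlicz_radius[OF \<phi>, of "sphere 0 1" "\<lambda>j. radial (K j)"])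
      (use K in \<open>auto simp: star_body_def\<close>)
  obtain S where S: "star_body S" "\<And>u. u \<in> sphere 0 1 \<Longrightarrow> radial S u = r u"
    using star_body_with_radial[OF r(1,2)] by blast
  let ?P = "\<lambda>S. star_body S \<and> (\<forall>u\<in>sphere 0 1. \<phi> (\<chi> j. radial (K j) u / radial S u) = 1)"
  have "?P (THE S. ?P S)"
  proof (rule theI[of ?P])
    show "?P S" using S r by simp
    show "S' = S" if "?P S'" for S'
      using that S r(3) by (intro star_body_eqI) (auto simp: star_body_def)
  qed
  then show "star_body (radial_orlicz_sum \<phi> K)"
    "\<And>u. u \<in> sphere 0 1 \<Longrightarrow> \<phi> (\<chi> j. radial (K j) u / radial (radial_orlicz_sum \<phi> K) u) = 1"
    unfolding radial_orlicz_sum_def by auto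
qed

section \<open>Jensen's inequality for a level set\<close>

text \<open>
  The vector \<open>b\<close> is the mean of \<open>x\<close> with respect to the density \<open>w\<close>, expressed through linear functionals.
  If \<open>b\<close> were outside the convex hull of the range of \<open>x\<close>, which is compact, a hyperplane would separate
  it strictly, and integrating the separation would give a contradiction. So \<open>b\<close> lies in the hull, and
  the hull lies in the sublevel set of \<open>f\<close>.
\<close>

lemma mean_in_sublevel:
  fixes x :: "'a::euclidean_space \<Rightarrow> 'b::euclidean_space"
  assumes n: "2 \<le> DIM('a)"
    and w: "continuous_on (sphere 0 1) w" "\<And>u. u \<in> sphere 0 1 \<Longrightarrow> 0 < w u"
    and x: "continuous_on (sphere 0 1) x" "\<And>u. u \<in> sphere 0 1 \<Longrightarrow> x u \<in> D"
    and f: "convex_on D f" "\<And>u. u \<in> sphere 0 1 \<Longrightarrow> f (x u) \<le> c"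
    and b: "\<And>a. (a \<bullet> b) * (\<integral>u. w u \<partial>sphere_measure) = (\<integral>u. w u * (a \<bullet> x u) \<partial>sphere_measure)"
  shows "b \<in> D \<and> f b \<le> c"
proof -
  define H where "H = convex hull (x ` sphere 0 1)"
  have "convex {z \<in> D. f z \<le> c}"
    unfolding convex_def
  proof clarify
    fix y z and s t :: real
    assume yz: "y \<in> D" "f y \<le> c" "z \<in> D" "f z \<le> c" and st: "0 \<le> s" "0 \<le> t" "s + t = 1"
    have "f (s *\<^sub>R y + t *\<^sub>R z) \<le> s * f y + t * f z"
      using f(1) yz st by (simp add: convex_on_def)
    also have "\<dots> \<le> c" using yz st by (intro convex_bound_le) auto
    finally show "s *\<^sub>R y + t *\<^sub>R z \<in> D \<and> f (s *\<^sub>R y + t *\<^sub>R z) \<le> c"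
      using f(1) yz st by (auto simp: convex_on_def convex_def)
  qed
  then have "H \<subseteq> {z \<in> D. f z \<le> c}"
    unfolding H_def using x(2) f(2) by (intro hull_minimal) auto
  moreover have "b \<in> H"
  proof (rule ccontr)
    assume "b \<notin> H"
    moreover have "compact H"
      unfolding H_def using x(1) by (intro compact_convex_hull compact_continuous_image) auto
    ultimately obtain a k where ak: "a \<bullet> b < k" "\<And>z. z \<in> H \<Longrightarrow> k < a \<bullet> z"
      using separating_hyperplane_closed_point[of H b] by (auto simp: H_def compact_imp_closed)
    have above: "a \<bullet> b < a \<bullet> x u" if "u \<in> sphere 0 1" for u
    proof -
      have "x u \<in> H" unfolding H_def using that by (intro hull_inc) auto
      then show ?thesis using ak by force
    qed
    obtain u0 :: 'a where "u0 \<in> sphere 0 1" using polar_decomposition by blast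
    then have "0 < (\<integral>u. w u * (a \<bullet> x u) - (a \<bullet> b) * w u \<partial>sphere_measure)"
      using above w x
      by (intro integral_sphere_measure_pos[OF n, of _ u0] continuous_intros)
        (auto simp: algebra_simps less_imp_le)
    also have "\<dots> = (\<integral>u. w u * (a \<bullet> x u) \<partial>sphere_measure) - (a \<bullet> b) * (\<integral>u. w u \<partial>sphere_measure)"
      using w x by (subst Bochner_Integration.integral_diff)
        (auto intro!: integrable_sphere_measure continuous_intros)
    also have "\<dots> = 0" by (simp add: b)
    finally show False by simp
  qed
  ultimately show ?thesis by blast
qed

text \<open>
  The convex set \<open>L\<close> where \<open>f < c\<close> does not contain \<open>b\<close>, so a hyperplane through \<open>b\<close> bounds it; as \<open>L\<close> is
  open, it lies strictly on one side. By strict convexity \<open>L\<close> contains the midpoint of \<open>b\<close> and any value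
  \<open>x v \<noteq> b\<close>, so such values lie strictly on the same side. As \<open>b\<close> is the mean of \<open>x\<close>, there are none.
\<close>

lemma mean_on_level_imp_constant:
  fixes x :: "'a::euclidean_space \<Rightarrow> 'b::euclidean_space"
  assumes n: "2 \<le> DIM('a)"
    and w: "continuous_on (sphere 0 1) w" "\<And>u. u \<in> sphere 0 1 \<Longrightarrow> 0 < w u"
    and x: "continuous_on (sphere 0 1) x" "\<And>u. u \<in> sphere 0 1 \<Longrightarrow> x u \<in> D"
    and f: "convex_on D f" "strictly_convex_on D f" "open D" "\<And>u. u \<in> sphere 0 1 \<Longrightarrow> f (x u) \<le> c"
    and b: "\<And>a. (a \<bullet> b) * (\<integral>u. w u \<partial>sphere_measure) = (\<integral>u. w u * (a \<bullet> x u) \<partial>sphere_measure)"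
    and fb: "f b = c" and u: "u \<in> sphere 0 1"
  shows "x u = b"
proof (rule ccontr)
  assume neq: "x u \<noteq> b"
  have bD: "b \<in> D" using mean_in_sublevel[OF n w x f(1,4) b] by blast
  define L where "L = {z \<in> D. f z < c}"
  have "continuous_on D f" by (rule convex_on_continuous[OF f(3,1)])
  from continuous_open_preimage[OF this f(3) open_lessThan[of c]] have "open L"
    by (simp add: L_def Int_def vimage_def)
  have "convex L"
    unfolding convex_def L_def
  proof clarify
    fix y z and s t :: real
    assume yz: "y \<in> D" "f y < c" "z \<in> D" "f z < c" and st: "0 \<le> s" "0 \<le> t" "s + t = 1"
    have "f (s *\<^sub>R y + t *\<^sub>R z) \<le> s * f y + t * f z"
      using f(1) yz st by (simp add: convex_on_def)
    also have "\<dots> < c" using yz st by (intro convex_bound_lt) auto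
    finally show "s *\<^sub>R y + t *\<^sub>R z \<in> D \<and> f (s *\<^sub>R y + t *\<^sub>R z) < c"
      using f(1) yz st by (auto simp: convex_on_def convex_def)
  qed
  have mid: "(1/2) *\<^sub>R x v + (1/2) *\<^sub>R b \<in> L" if v: "v \<in> sphere 0 1" "x v \<noteq> b" for v
  proof -
    have half: "0 < (1/2::real)" "(1/2::real) + 1/2 = 1" by simp_all
    have "f ((1/2) *\<^sub>R x v + (1/2) *\<^sub>R b) < (1/2) * f (x v) + (1/2) * f b"
      using f(2) x(2)[OF v(1)] bD half v(2) unfolding strictly_convex_on_def by blast
    moreover have "(1/2) *\<^sub>R x v + (1/2) *\<^sub>R b \<in> D"
      using f(1) x(2)[OF v(1)] bD by (auto simp: convex_on_def convex_def)
    ultimately show ?thesis using f(4)[OF v(1)] fb by (simp add: L_def)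
  qed
  have "b \<notin> L" using fb by (simp add: L_def)
  then obtain a k where a: "a \<noteq> 0" and ak: "a \<bullet> b \<le> k" "\<And>z. z \<in> L \<Longrightarrow> k \<le> a \<bullet> z"
    using separating_hyperplane_sets[of "{b}" L] \<open>convex L\<close> mid[OF u neq] by auto
  have strict: "a \<bullet> b < a \<bullet> z" if "z \<in> L" for z
  proof -
    obtain e where e: "0 < e" "ball z e \<subseteq> L" using \<open>open L\<close> \<open>z \<in> L\<close> open_contains_ball by blast
    \<comment> \<open>A step of length e / 2 from z towards the hyperplane stays in L.\<close>
    have "z - (e / (2 * norm a)) *\<^sub>R a \<in> L" using e a by (intro subsetD[OF e(2)]) (simp add: dist_norm)
    then have "k \<le> a \<bullet> z - (e / (2 * norm a)) * (a \<bullet> a)"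
      using ak(2) by (fastforce simp: inner_diff_right)
    moreover have "0 < (e / (2 * norm a)) * (a \<bullet> a)" using e a by simp
    ultimately show ?thesis using ak(1) by linarith
  qed
  have above: "a \<bullet> b < a \<bullet> x v" if v: "v \<in> sphere 0 1" "x v \<noteq> b" for v
    using strict[OF mid[OF v]] by (simp add: inner_add_right)
  have above_eq: "a \<bullet> b \<le> a \<bullet> x v" if "v \<in> sphere 0 1" for v
    using above[OF that] by (cases "x v = b") auto
  have "0 < (\<integral>v. w v * (a \<bullet> x v) - (a \<bullet> b) * w v \<partial>sphere_measure)"
  proof (rule integral_sphere_measure_pos[OF n _ _ u])
    show "continuous_on (sphere 0 1) (\<lambda>v. w v * (a \<bullet> x v) - (a \<bullet> b) * w v)"
      by (intro continuous_intros w x)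
    show "0 \<le> w v * (a \<bullet> x v) - (a \<bullet> b) * w v" if "v \<in> sphere 0 1" for v
      using mult_right_mono[OF above_eq[OF that] less_imp_le[OF w(2)[OF that]]] by (simp add: mult.commute)
    show "0 < w u * (a \<bullet> x u) - (a \<bullet> b) * w u"
      using mult_strict_right_mono[OF above[OF u neq] w(2)[OF u]] by (simp add: mult.commute)
  qed
  also have "\<dots> = (\<integral>u. w u * (a \<bullet> x u) \<partial>sphere_measure) - (a \<bullet> b) * (\<integral>u. w u \<partial>sphere_measure)"
    using w x by (subst Bochner_Integration.integral_diff)
      (auto intro!: integrable_sphere_measure continuous_intros)
  also have "\<dots> = 0" by (simp add: b)
  finally show False by simp
qed

section \<open>The inequality for the general dual volume\<close>

lemma phi_q_Phi_bar_order:
  fixes \<phi> :: "real^'m \<Rightarrow> real"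
  assumes \<phi>: "\<phi> \<in> Phi_bar" and q: "q \<noteq> 0" and x: "x \<in> pos_orthant"
  shows "q > 0 \<Longrightarrow> phi_q \<phi> q x = 1 \<Longrightarrow> x $ j \<le> 1"
    and "q < 0 \<Longrightarrow> phi_q \<phi> q x = 1 \<Longrightarrow> 1 \<le> x $ j"
    and "q > 0 \<Longrightarrow> (\<And>j. x $ j \<le> y $ j) \<Longrightarrow> phi_q \<phi> q x \<le> phi_q \<phi> q y"
    and "q < 0 \<Longrightarrow> (\<And>j. x $ j \<le> y $ j) \<Longrightarrow> phi_q \<phi> q y \<le> phi_q \<phi> q x"
proof -
  have pos: "0 < x $ j" for j using x by (simp add: pos_orthant_def)
  have le: "x $ j powr (1 / q) \<le> 1" if "phi_q \<phi> q x = 1"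
    using Phi_bar_le_1_imp[OF \<phi>, of "\<chi> j. x $ j powr (1 / q)" j] that by (simp add: phi_q_def)
  have "x $ j = (x $ j powr (1 / q)) powr q" using pos[of j] q by (simp add: powr_powr)
  then show "q > 0 \<Longrightarrow> phi_q \<phi> q x = 1 \<Longrightarrow> x $ j \<le> 1"
    and "q < 0 \<Longrightarrow> phi_q \<phi> q x = 1 \<Longrightarrow> 1 \<le> x $ j"
    using le pos[of j] powr_mono2[of q "x $ j powr (1 / q)" 1] powr_mono2'[of q "x $ j powr (1 / q)" 1]
    by auto
  show "q > 0 \<Longrightarrow> (\<And>j. x $ j \<le> y $ j) \<Longrightarrow> phi_q \<phi> q x \<le> phi_q \<phi> q y"
    unfolding phi_q_def using pos
    by (intro Phi_bar_mono[OF \<phi>]) (auto simp: less_imp_le intro!: powr_mono2)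
  show "q < 0 \<Longrightarrow> (\<And>j. x $ j \<le> y $ j) \<Longrightarrow> phi_q \<phi> q y \<le> phi_q \<phi> q x"
    unfolding phi_q_def using pos
    by (intro Phi_bar_mono[OF \<phi>]) (auto simp: less_imp_le intro!: powr_mono2')
qed

text \<open>
  Inverting the coordinates changes the sign of the exponent, which reduces \<^const>\<open>Psi\<close> to
  \<^const>\<open>Phi_bar\<close>.
\<close>

lemma phi_q_Psi:
  fixes \<phi> :: "real^'m \<Rightarrow> real"
  assumes "\<phi> \<in> Psi"
  obtains \<phi>0 where "\<phi>0 \<in> Phi_bar" "\<And>q x. x \<in> pos_orthant \<Longrightarrow> phi_q \<phi> q x = phi_q \<phi>0 (- q) x"
proof -
  from assms obtain \<phi>0 where \<phi>0: "\<phi>0 \<in> Phi_bar" "\<And>x. x \<in> pos_orthant \<Longrightarrow> \<phi> x = \<phi>0 (\<chi> j. 1 / x $ j)"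
    by (auto simp: Psi_def)
  have "phi_q \<phi> q x = phi_q \<phi>0 (- q) x" if "x \<in> pos_orthant" for q x
  proof -
    have "(\<chi> j. x $ j powr (1 / q)) \<in> pos_orthant"
      using that by (auto simp: pos_orthant_def) (metis less_irrefl)
    then show ?thesis
      unfolding phi_q_def by (subst \<phi>0(2)) (simp_all add: powr_minus_divide)
  qed
  with \<phi>0(1) show ?thesis using that by blast
qed

text \<open>
  Either \<open>phi_q \<phi> q\<close> is increasing and its level set at \<open>1\<close> lies below the vector of ones, or it is
  decreasing and the level set lies above. The comparison of volumes below depends on \<open>\<phi>\<close> and on the sign
  of \<open>q\<close> only through this alternative.
\<close>

lemma phi_q_order_cases:
  fixes \<phi> :: "real^'m \<Rightarrow> real"
  assumes \<phi>: "\<phi> \<in> Phi_bar \<union> Psi" and q: "q \<noteq> 0"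
  obtains
    (increasing) "\<And>x j. x \<in> pos_orthant \<Longrightarrow> phi_q \<phi> q x = 1 \<Longrightarrow> x $ j \<le> 1"
      "\<And>x y. x \<in> pos_orthant \<Longrightarrow> y \<in> pos_orthant \<Longrightarrow> (\<And>j. x $ j \<le> y $ j) \<Longrightarrow> phi_q \<phi> q x \<le> phi_q \<phi> q y"
  | (decreasing) "\<And>x j. x \<in> pos_orthant \<Longrightarrow> phi_q \<phi> q x = 1 \<Longrightarrow> 1 \<le> x $ j"
      "\<And>x y. x \<in> pos_orthant \<Longrightarrow> y \<in> pos_orthant \<Longrightarrow> (\<And>j. x $ j \<le> y $ j) \<Longrightarrow> phi_q \<phi> q y \<le> phi_q \<phi> q x"
proof (cases "\<phi> \<in> Phi_bar")
  case True
  note order = phi_q_Phi_bar_order[OF True q]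
  show ?thesis
  proof (cases "q > 0")
    case True
    then show ?thesis by (intro increasing order(1,3))
  next
    case False
    with q have "q < 0" by simp
    then show ?thesis by (intro decreasing order(2,4))
  qed
next
  case False
  with \<phi> have "\<phi> \<in> Psi" by blast
  then obtain \<phi>0 where \<phi>0: "\<phi>0 \<in> Phi_bar"
    and eq: "\<And>q x. x \<in> pos_orthant \<Longrightarrow> phi_q \<phi> q x = phi_q \<phi>0 (- q) x"
    using phi_q_Psi by blast
  have "- q \<noteq> 0" using q by simp
  note order = phi_q_Phi_bar_order[OF \<phi>0 this]
  show ?thesis
  proof (cases "q < 0")
    case True
    then have "- q > 0" by simp
    then show ?thesis using order(1,3) eq by (intro increasing) simp_all
  next
    case False
    with q have "- q < 0" by simp
    then show ?thesis using order(2,4) eq by (intro decreasing) simp_all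
  qed
qed

lemma powr_compare_1:
  fixes r q :: real
  assumes "0 < r"
  shows "q > 0 \<Longrightarrow> r powr q \<le> 1 \<longleftrightarrow> r \<le> 1" and "q < 0 \<Longrightarrow> r powr q \<le> 1 \<longleftrightarrow> 1 \<le> r"
    and "q > 0 \<Longrightarrow> 1 \<le> r powr q \<longleftrightarrow> 1 \<le> r" and "q < 0 \<Longrightarrow> 1 \<le> r powr q \<longleftrightarrow> r \<le> 1"
  using assms by (auto simp: powr_def mult_le_0_iff zero_le_mult_iff)

theorem theorem7p1:
  fixes \<phi> :: "real^'m \<Rightarrow> real"
    and K :: "'m \<Rightarrow> (real^'n) set"
    and S :: "(real^'n) set"
    and G :: "real \<Rightarrow> real^'n \<Rightarrow> real"
    and q :: real
  assumes "CARD('m) \<ge> 2" and "CARD('n) \<ge> 2"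
    and "\<phi> \<in> Phi_bar \<union> Psi"
    and "\<And>j. star_body (K j)"
    and "continuous_on ({0<..} \<times> sphere 0 1) (\<lambda>(t, u). G t u)"
    and "\<And>t u. t > 0 \<Longrightarrow> u \<in> sphere 0 1 \<Longrightarrow> G t u > 0"
    and "q \<noteq> 0"
    and "S = radial_orlicz_sum \<phi> K"
  shows
    "let r = \<phi> (\<chi> j. (dual_volume G (K j) / dual_volume G S) powr (1 / q));
         incr = (\<forall>u\<in>sphere 0 1. mono_on {0<..} (\<lambda>t. G_q G q t u));
         decr = (\<forall>u\<in>sphere 0 1. antimono_on {0<..} (\<lambda>t. G_q G q t u))
     in
       (convex_on pos_orthant (phi_q \<phi> q) \<and> (q > 0 \<and> incr \<or> q < 0 \<and> decr) \<longrightarrow>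
          1 \<ge> r \<and>
          (strictly_convex_on pos_orthant (phi_q \<phi> q) \<and> 1 = r \<longrightarrow>
             (\<forall>i j. dilatates (K i) (K j)))) \<and>
       (concave_on pos_orthant (phi_q \<phi> q) \<and> (q > 0 \<and> decr \<or> q < 0 \<and> incr) \<longrightarrow>
          1 \<le> r \<and>
          (strictly_concave_on pos_orthant (phi_q \<phi> q) \<and> 1 = r \<longrightarrow>
             (\<forall>i j. dilatates (K i) (K j))))"
proof -
  note n = \<open>CARD('n) \<ge> 2\<close> and \<phi> = \<open>\<phi> \<in> Phi_bar \<union> Psi\<close> and K = \<open>\<And>j. star_body (K j)\<close>
    and G_cont = \<open>continuous_on ({0<..} \<times> sphere 0 1) (\<lambda>(t, u). G t u)\<close>
    and G_pos = \<open>\<And>t u. t > 0 \<Longrightarrow> u \<in> sphere 0 1 \<Longrightarrow> G t u > 0\<close> and q = \<open>q \<noteq> 0\<close>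
  have DIM: "2 \<le> DIM(real^'n)" using n by simp
  define \<rho> where "\<rho> j = radial (K j)" for j
  define s where "s = radial S"
  define w where "w u = G (s u) u" for u
  \<comment> \<open>The mean of x for the density w is b; the vector y collects the quotients of dual volumes.\<close>
  define x :: "real^'n \<Rightarrow> real^'m" where "x u = (\<chi> j. (\<rho> j u / s u) powr q)" for u
  define W where "W = (\<integral>u. w u \<partial>sphere_measure)"
  define V where "V j = (\<integral>u. G (\<rho> j u) u \<partial>sphere_measure)" for j
  define b :: "real^'m" where "b = (\<chi> j. (\<integral>u. w u * x u $ j \<partial>sphere_measure) / W)"
  define y :: "real^'m" where "y = (\<chi> j. V j / W)"
  define f where "f = phi_q \<phi> q"
  have S: "star_body S" and S_eq: "\<And>u. u \<in> sphere 0 1 \<Longrightarrow> \<phi> (\<chi> j. \<rho> j u / s u) = 1"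
    using radial_orlicz_sum_props[OF \<phi> K] \<open>S = radial_orlicz_sum \<phi> K\<close> by (auto simp: \<rho>_def s_def)
  have \<rho>: "continuous_on (sphere 0 1) (\<rho> j)" "\<And>u. u \<in> sphere 0 1 \<Longrightarrow> 0 < \<rho> j u" for j
    using K by (auto simp: \<rho>_def star_body_def)
  have s: "continuous_on (sphere 0 1) s" "\<And>u. u \<in> sphere 0 1 \<Longrightarrow> 0 < s u"
    using S by (auto simp: s_def star_body_def)
  have G_comp: "continuous_on (sphere 0 1) (\<lambda>u. G (g u) u)"
    if "continuous_on (sphere 0 1) g" "\<And>u. u \<in> sphere 0 1 \<Longrightarrow> 0 < g u" for g
  proof -
    have "continuous_on (sphere 0 1) (\<lambda>u. (\<lambda>(t, u). G t u) (g u, u))"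
      by (rule continuous_on_compose2[OF G_cont]) (use that in \<open>auto intro!: continuous_intros\<close>)
    then show ?thesis by simp
  qed
  have w: "continuous_on (sphere 0 1) w" "\<And>u. u \<in> sphere 0 1 \<Longrightarrow> 0 < w u"
    unfolding w_def using G_comp[OF s] G_pos s(2) by auto
  have ratio_pos: "0 < \<rho> j u / s u" if "u \<in> sphere 0 1" for j u
    using \<rho>(2)[OF that] s(2)[OF that] by simp
  have x_cont_j: "continuous_on (sphere 0 1) (\<lambda>u. x u $ j)" for j
  proof -
    have "\<forall>u\<in>sphere 0 1. s u \<noteq> 0" "\<forall>u\<in>sphere 0 1. \<rho> j u / s u \<noteq> 0"
      using s(2) ratio_pos[of _ j] by (metis less_irrefl)+
    then have "continuous_on (sphere 0 1) (\<lambda>u. (\<rho> j u / s u) powr q)"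
      by (intro continuous_on_powr continuous_on_divide continuous_on_const \<rho>(1) s(1))
    then show ?thesis by (simp add: x_def)
  qed
  have x_cont: "continuous_on (sphere 0 1) x"
  proof -
    have "continuous_on (sphere 0 1) (\<lambda>u. \<chi> j. x u $ j)"
      by (rule continuous_on_vec_lambda) (rule x_cont_j)
    then show ?thesis by simp
  qed
  have x_pos_j: "0 < x u $ j" if "u \<in> sphere 0 1" for u j
    using \<rho>(2)[OF that, of j] s(2)[OF that] by (simp add: x_def)
  then have x_pos: "x u \<in> pos_orthant" if "u \<in> sphere 0 1" for u
    using that by (simp add: pos_orthant_def)
  have x_root: "x u $ j powr (1 / q) = \<rho> j u / s u" if "u \<in> sphere 0 1" for u j
    using \<rho>(2)[OF that, of j] s(2)[OF that] q by (simp add: x_def powr_powr)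
  then have fx: "f (x u) = 1" if "u \<in> sphere 0 1" for u
    using S_eq[OF that] that by (simp add: f_def phi_q_def)
  have integral_pos: "0 < (\<integral>u. g u \<partial>sphere_measure)"
    if "continuous_on (sphere 0 1) g" "\<And>u. u \<in> sphere 0 1 \<Longrightarrow> 0 < g u" for g :: "real^'n \<Rightarrow> real"
  proof -
    obtain u0 :: "real^'n" where "u0 \<in> sphere 0 1" using polar_decomposition by blast
    then show ?thesis
      using that by (intro integral_sphere_measure_pos[OF DIM, of g u0]) (auto intro: less_imp_le)
  qed
  have W_pos: "0 < W" unfolding W_def by (rule integral_pos[OF w])
  have V_pos: "0 < V j" for j
    unfolding V_def by (rule integral_pos[OF G_comp[OF \<rho>]]) (use G_pos \<rho>(2) in auto)
  have wx_cont: "continuous_on (sphere 0 1) (\<lambda>u. w u * x u $ j)" for j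
    by (intro continuous_on_mult w x_cont_j)
  have wx_pos: "0 < (\<integral>u. w u * x u $ j \<partial>sphere_measure)" for j
    by (rule integral_pos[OF wx_cont]) (use w(2) x_pos_j in auto)
  have y_pos: "y \<in> pos_orthant" and b_pos: "b \<in> pos_orthant"
    using V_pos W_pos wx_pos by (simp_all add: pos_orthant_def y_def b_def)
  have mean: "(a \<bullet> b) * (\<integral>u. w u \<partial>sphere_measure) = (\<integral>u. w u * (a \<bullet> x u) \<partial>sphere_measure)" for a
  proof -
    have "(a \<bullet> b) * W = (\<Sum>j\<in>UNIV. a $ j * (\<integral>u. w u * x u $ j \<partial>sphere_measure))"
      using W_pos by (simp add: inner_vec_def b_def sum_distrib_right)
    also have "\<dots> = (\<integral>u. (\<Sum>j\<in>UNIV. a $ j * (w u * x u $ j)) \<partial>sphere_measure)"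
      by (subst Bochner_Integration.integral_sum)
        (auto intro!: integrable_sphere_measure wx_cont Bochner_Integration.integrable_mult_right)
    also have "\<dots> = (\<integral>u. w u * (a \<bullet> x u) \<partial>sphere_measure)"
      by (simp add: inner_vec_def sum_distrib_left mult_ac)
    finally show ?thesis by (simp add: W_def)
  qed
  have wx: "w u * x u $ j = G_q G q (s u) u * \<rho> j u powr q"
    and G\<rho>: "G (\<rho> j u) u = G_q G q (\<rho> j u) u * \<rho> j u powr q" if "u \<in> sphere 0 1" for u j
    using \<rho>(2)[OF that, of j] s(2)[OF that] by (simp_all add: w_def x_def G_q_def powr_divide)
  \<comment> \<open>With G written as G_q times a power, the integrands of V j and of b $ j differ only in the factor G_q.\<close>
  have y_le_b: "y $ j \<le> b $ j"
    if "\<And>u. u \<in> sphere 0 1 \<Longrightarrow> G_q G q (\<rho> j u) u \<le> G_q G q (s u) u" for j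
  proof -
    have "V j \<le> (\<integral>u. w u * x u $ j \<partial>sphere_measure)"
      unfolding V_def
      by (intro integral_mono integrable_sphere_measure wx_cont G_comp \<rho>)
        (use that in \<open>auto simp: wx G\<rho> intro!: mult_right_mono\<close>)
    then show ?thesis using W_pos by (simp add: y_def b_def divide_right_mono)
  qed
  have b_le_y: "b $ j \<le> y $ j"
    if "\<And>u. u \<in> sphere 0 1 \<Longrightarrow> G_q G q (s u) u \<le> G_q G q (\<rho> j u) u" for j
  proof -
    have "(\<integral>u. w u * x u $ j \<partial>sphere_measure) \<le> V j"
      unfolding V_def
      by (intro integral_mono integrable_sphere_measure wx_cont G_comp \<rho>)
        (use that in \<open>auto simp: wx G\<rho> intro!: mult_right_mono\<close>)
    then show ?thesis using W_pos by (simp add: y_def b_def divide_right_mono)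
  qed
  have order_x: "q > 0 \<Longrightarrow> x u $ j \<le> 1 \<Longrightarrow> \<rho> j u \<le> s u" "q < 0 \<Longrightarrow> x u $ j \<le> 1 \<Longrightarrow> s u \<le> \<rho> j u"
    "q > 0 \<Longrightarrow> 1 \<le> x u $ j \<Longrightarrow> s u \<le> \<rho> j u" "q < 0 \<Longrightarrow> 1 \<le> x u $ j \<Longrightarrow> \<rho> j u \<le> s u"
    if "u \<in> sphere 0 1" for u j
    using powr_compare_1[OF ratio_pos[OF that, of j], of q] s(2)[OF that] by (auto simp: x_def)
  define incr where "incr = (\<forall>u\<in>sphere 0 1. mono_on {0<..} (\<lambda>t. G_q G q t u))"
  define decr where "decr = (\<forall>u\<in>sphere 0 1. antimono_on {0<..} (\<lambda>t. G_q G q t u))"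
  have incrD: "G_q G q t u \<le> G_q G q t' u" if "incr" "u \<in> sphere 0 1" "0 < t" "t \<le> t'" for t t' u
  proof -
    have "mono_on {0<..} (\<lambda>t. G_q G q t u)" using that(1,2) unfolding incr_def by blast
    from mono_onD[OF this, of t t'] show ?thesis using that(3,4) by simp
  qed
  have decrD: "G_q G q t' u \<le> G_q G q t u" if "decr" "u \<in> sphere 0 1" "0 < t" "t \<le> t'" for t t' u
  proof -
    have "antimono_on {0<..} (\<lambda>t. G_q G q t u)" using that(1,2) unfolding decr_def by blast
    from monotone_onD[OF this, of t t'] show ?thesis using that(3,4) by simp
  qed
  \<comment> \<open>Here G_q increases with the q-th power of its first argument, whatever the sign of q.\<close>
  have fy_le: "f y \<le> f b" if A: "q > 0 \<and> incr \<or> q < 0 \<and> decr"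
  proof -
    have le: "G_q G q (\<rho> j u) u \<le> G_q G q (s u) u" if "u \<in> sphere 0 1" "x u $ j \<le> 1" for u j
      using A order_x(1,2)[OF that(1) _ that(2)] incrD decrD \<rho>(2) s(2) that(1) by blast
    have ge: "G_q G q (s u) u \<le> G_q G q (\<rho> j u) u" if "u \<in> sphere 0 1" "1 \<le> x u $ j" for u j
      using A order_x(3,4)[OF that(1) _ that(2)] incrD decrD \<rho>(2) s(2) that(1) by blast
    from \<phi> q show ?thesis
    proof (cases rule: phi_q_order_cases)
      case increasing
      show ?thesis unfolding f_def
        by (intro increasing(2) y_pos b_pos y_le_b le increasing(1) x_pos fx[unfolded f_def])
    next
      case decreasing
      show ?thesis unfolding f_def
        by (intro decreasing(2) y_pos b_pos b_le_y ge decreasing(1) x_pos fx[unfolded f_def])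
    qed
  qed
  \<comment> \<open>Here G_q decreases with the q-th power of its first argument.\<close>
  have fy_ge: "f b \<le> f y" if B: "q > 0 \<and> decr \<or> q < 0 \<and> incr"
  proof -
    have le: "G_q G q (\<rho> j u) u \<le> G_q G q (s u) u" if "u \<in> sphere 0 1" "1 \<le> x u $ j" for u j
      using B order_x(3,4)[OF that(1) _ that(2)] incrD decrD \<rho>(2) s(2) that(1) by blast
    have ge: "G_q G q (s u) u \<le> G_q G q (\<rho> j u) u" if "u \<in> sphere 0 1" "x u $ j \<le> 1" for u j
      using B order_x(1,2)[OF that(1) _ that(2)] incrD decrD \<rho>(2) s(2) that(1) by blast
    from \<phi> q show ?thesis
    proof (cases rule: phi_q_order_cases)
      case increasing
      show ?thesis unfolding f_def
        by (intro increasing(2) y_pos b_pos b_le_y ge increasing(1) x_pos fx[unfolded f_def])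
    next
      case decreasing
      show ?thesis unfolding f_def
        by (intro decreasing(2) y_pos b_pos y_le_b le decreasing(1) x_pos fx[unfolded f_def])
    qed
  qed
  have dil: "dilatates (K i) (K j)" if const: "\<And>u. u \<in> sphere 0 1 \<Longrightarrow> x u = b" for i j
  proof -
    define c where "c l = b $ l powr (1 / q)" for l
    have c_pos: "0 < c l" for l
      using b_pos by (simp add: c_def pos_orthant_def) (metis less_irrefl)
    have \<rho>_c: "\<rho> l u = c l * s u" if "u \<in> sphere 0 1" for l u
      using x_root[OF that, of l] const[OF that] s(2)[OF that] by (simp add: c_def field_simps)
    show ?thesis
    proof (rule dilatatesI[OF K K])
      show "0 < c i / c j" using c_pos by simp
      show "radial (K i) u = c i / c j * radial (K j) u" if "u \<in> sphere 0 1" for u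
        using \<rho>_c[OF that, of i] \<rho>_c[OF that, of j] c_pos[of j] by (simp add: \<rho>_def)
    qed
  qed
  have open_pos: "open (pos_orthant :: (real^'m) set)"
  proof -
    have "pos_orthant = (\<Inter>j\<in>UNIV. {z :: real^'m. 0 < z $ j})" by (auto simp: pos_orthant_def)
    also have "open \<dots>" by (intro open_INT ballI finite open_Collect_less continuous_intros)
    finally show ?thesis .
  qed
  have r_eq: "\<phi> (\<chi> j. (dual_volume G (K j) / dual_volume G S) powr (1 / q)) = f y"
    by (simp add: f_def phi_q_def y_def V_def W_def w_def \<rho>_def s_def dual_volume_eq)
  have convex_case: "f y \<le> 1 \<and> (strictly_convex_on pos_orthant f \<and> 1 = f y \<longrightarrow> (\<forall>i j. dilatates (K i) (K j)))"
    if conv: "convex_on pos_orthant f" and A: "q > 0 \<and> incr \<or> q < 0 \<and> decr"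
  proof -
    have level: "f (x u) \<le> 1" if "u \<in> sphere 0 1" for u using fx[OF that] by simp
    have fb: "f b \<le> 1"
      using mean_in_sublevel[OF DIM w x_cont x_pos conv level mean] by blast
    moreover have "dilatates (K i) (K j)" if strict: "strictly_convex_on pos_orthant f" "1 = f y" for i j
    proof (rule dil)
      have "f b = 1" using fb fy_le[OF A] strict(2) by simp
      then show "x u = b" if "u \<in> sphere 0 1" for u
        by (intro mean_on_level_imp_constant[OF DIM w x_cont x_pos conv strict(1) open_pos level mean] that)
    qed
    ultimately show ?thesis using fy_le[OF A] by auto
  qed
  have concave_case: "1 \<le> f y \<and> (strictly_concave_on pos_orthant f \<and> 1 = f y \<longrightarrow> (\<forall>i j. dilatates (K i) (K j)))"
    if conc: "concave_on pos_orthant f" and B: "q > 0 \<and> decr \<or> q < 0 \<and> incr"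
  proof -
    have conv: "convex_on pos_orthant (\<lambda>z. - f z)" using conc by (simp add: concave_on_def)
    have level: "- f (x u) \<le> - 1" if "u \<in> sphere 0 1" for u using fx[OF that] by simp
    have fb: "1 \<le> f b"
      using mean_in_sublevel[OF DIM w x_cont x_pos conv level mean] by simp
    moreover have "dilatates (K i) (K j)" if strict: "strictly_concave_on pos_orthant f" "1 = f y" for i j
    proof (rule dil)
      have strict': "strictly_convex_on pos_orthant (\<lambda>z. - f z)"
        using strict(1) by (simp add: strictly_concave_on_def)
      have "- f b = - 1" using fb fy_ge[OF B] strict(2) by simp
      then show "x u = b" if "u \<in> sphere 0 1" for u
        by (intro mean_on_level_imp_constant[OF DIM w x_cont x_pos conv strict' open_pos level mean] that)
    qed
    ultimately show ?thesis using fy_ge[OF B] by auto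
  qed
  show ?thesis
    unfolding Let_def r_eq f_def[symmetric] incr_def[symmetric] decr_def[symmetric]
    using convex_case concave_case by blast
qed

end
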